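(* Let $n\ge 2$, let $(M^n,g)$ be an $n$-dimensional compact oriented conformally flat Riemannian manifold with boundary, and let $\boldsymbol{p}:M^n\to\Lambda^{n+1}$ be an isometric immersion. For any admissible variation $F:(-\varepsilon,\varepsilon)\times M^n\to\mathbb{R}^{n+2}_1$ of $\boldsymbol{p}$ with fixed boundary, with variational vector field $X$, the first variation of the volume is given by \[\left.\frac{d}{dt}\right|_{t=0}\mathrm{Vol}(t)=-\int_{M^n}\mathrm{tr}(A)\,\langle X,\boldsymbol{p}\rangle\,dV_0,\] where $A$ is the shape operator of $\boldsymbol{p}$.
   Context: $\mathbb{R}^{n+2}_1$ is the Minkowski spacetime of signature $(-,+,\dots,+)$ with Lorentzian inner product $\langle\cdot,\cdot\rangle$ and Levi-Civita (flat) connection $\overline{\nabla}$, and $\Lambda^{n+1}=\{\boldsymbol{x}\in\mathbb{R}^{n+2}_1 : \langle \boldsymbol{x},\boldsymbol{x}\rangle=0\}$ is the light-cone. An isometric immersion $\boldsymbol{p}:M^n\to\Lambda^{n+1}$ is a smooth immersion $\boldsymbol{p}:M^n\to\mathbb{R}^{n+2}_1$ with image in $\Lambda^{n+1}$ such that $\boldsymbol{p}^*\langle\cdot,\cdot\rangle=g$. Tangent vectors of $M^n$ are identified with vectors of $\mathbb{R}^{n+2}_1$ via $d\boldsymbol{p}$. Dual map: there is a unique smooth map $\boldsymbol{q}:M^n\to\Lambda^{n+1}$ with $\langle\boldsymbol{p},\boldsymbol{q}\rangle=1$ and $\langle d\boldsymbol{p}(Y),\boldsymbol{q}\rangle=0$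 for all tangent vector fields $Y$ on $M^n$; it is called the dual map of $\boldsymbol{p}$. Shape operator: with $\mathrm{II}(Y,Z)=(\overline{\nabla}_YZ)^\perp$ the second fundamental form of $\boldsymbol{p}$ in $\mathbb{R}^{n+2}_1$ ($\perp$ = projection to the normal bundle), $A$ is the endomorphism of $TM^n$ defined by $\langle AY,Z\rangle=\langle \mathrm{II}(Y,Z),\boldsymbol{q}\rangle$. Variations: a variation of $\boldsymbol{p}$ is a smooth map $F:(-\varepsilon,\varepsilon)\times M^n\to\mathbb{R}^{n+2}_1$ ($\varepsilon>0$) such that $F(0,x)=\boldsymbol{p}(x)$ and each $F(t,\cdot)$ is a spacelike immersion (the induced metric $g_t$ is Riemannian). It has fixed boundary if $F(t,x)=\boldsymbol{p}(x)$ for all $t$ and all $x\in\partial M^n$. $dV_t$ is the volume form of $(M^n,g_t)$ and $\mathrm{Vol}(t)=\int_{M^n}dV_t$. The variational vector field is $X=\frac{\partial}{\partial t}\big|_{t=0}F$. The variation $F$ is admissible if there is a real-valued function $\varphi$ on $M^n$ with $X=\varphi\,\boldsymbol{q}$. *)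

theory Defs
  imports "HOL-Analysis.Analysis"
begin

section \<open>Smooth maps on subsets of a Euclidean space\<close>

text \<open>For maps between Euclidean spaces and open \<open>S\<close>, this is the usual class of \<open>k\<close> times
  continuously differentiable maps.\<close>

primrec Ck_on :: "nat \<Rightarrow> 'a::real_normed_vector set \<Rightarrow> ('a \<Rightarrow> 'b::real_normed_vector) \<Rightarrow> bool" where
  "Ck_on 0 S f \<longleftrightarrow> continuous_on S f"
| "Ck_on (Suc k) S f \<longleftrightarrow>
     (\<forall>x\<in>S. f differentiable (at x)) \<and> (\<forall>v. Ck_on k S (\<lambda>x. frechet_derivative f (at x) v))"

text \<open>On arbitrary \<open>S\<close> (below: relatively open subsets of a half-space), smoothness means that there
  are local smooth extensions to open sets.\<close>

definition smooth_on :: "'a::real_normed_vector set \<Rightarrow> ('a \<Rightarrow> 'b::real_normed_vector) \<Rightarrow> bool" where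
  "smooth_on S f \<longleftrightarrow>
     (\<forall>x\<in>S. \<exists>V f'. open V \<and> x \<in> V \<and> (\<forall>k. Ck_on k V f') \<and> (\<forall>y\<in>V \<inter> S. f' y = f y))"


section \<open>Smooth manifolds with boundary\<close>

text \<open>The model space is \<open>real ^ 'n\<close> with \<open>n = CARD('n)\<close>. Which coordinate is used to cut out the
  half-space is immaterial.\<close>

definition bdry_index :: "'n::finite" where
  "bdry_index = (SOME i. True)"

definition half_space :: "(real ^ 'n) set" where
  "half_space = {y. 0 \<le> y $ bdry_index}"

text \<open>A chart is a domain together with a map, of which only the values on the domain matter.\<close>

type_synonym ('m, 'n) chart = "'m set \<times> ('m \<Rightarrow> real ^ 'n)"

abbreviation cdom :: "('m, 'n) chart \<Rightarrow> 'm set" where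
  "cdom c \<equiv> fst c"

abbreviation cmap :: "('m, 'n) chart \<Rightarrow> 'm \<Rightarrow> real ^ 'n" where
  "cmap c \<equiv> snd c"

abbreviation cimg :: "('m, 'n) chart \<Rightarrow> (real ^ 'n) set" where
  "cimg c \<equiv> cmap c ` cdom c"

definition cinv :: "('m, 'n) chart \<Rightarrow> real ^ 'n \<Rightarrow> 'm" where
  "cinv c = inv_into (cdom c) (cmap c)"

definition chart_of :: "'m topology \<Rightarrow> ('m, 'n::finite) chart \<Rightarrow> bool" where
  "chart_of M c \<longleftrightarrow>
     openin M (cdom c) \<and> openin (top_of_set half_space) (cimg c) \<and>
     homeomorphic_map (subtopology M (cdom c)) (top_of_set (cimg c)) (cmap c)"

definition smooth_manifold_with_boundary :: "'m topology \<Rightarrow> ('m, 'n::finite) chart set \<Rightarrow> bool" where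
  "smooth_manifold_with_boundary M \<A> \<longleftrightarrow>
     Hausdorff_space M \<and> second_countable M \<and>
     (\<forall>c\<in>\<A>. chart_of M c) \<and> (\<Union>c\<in>\<A>. cdom c) = topspace M \<and>
     (\<forall>c\<in>\<A>. \<forall>c'\<in>\<A>. smooth_on (cmap c ` (cdom c \<inter> cdom c')) (cmap c' \<circ> cinv c))"

definition manifold_boundary :: "('m, 'n::finite) chart set \<Rightarrow> 'm set" where
  "manifold_boundary \<A> = {x. \<exists>c\<in>\<A>. x \<in> cdom c \<and> cmap c x $ bdry_index = 0}"

text \<open>An arbitrarily chosen chart around a point. It is only used in definitions whose value does not
  depend on the choice.\<close>

definition chart_at :: "('m, 'n) chart set \<Rightarrow> 'm \<Rightarrow> ('m, 'n) chart" where
  "chart_at \<A> x = (SOME c. c \<in> \<A> \<and> x \<in> cdom c)"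

definition smooth_map_on ::
    "('m, 'n::finite) chart set \<Rightarrow> 'm set \<Rightarrow> ('m \<Rightarrow> 'b::real_normed_vector) \<Rightarrow> bool" where
  "smooth_map_on \<A> U f \<longleftrightarrow> (\<forall>c\<in>\<A>. smooth_on (cmap c ` (cdom c \<inter> U)) (f \<circ> cinv c))"

text \<open>The derivative of \<open>f\<close> at \<open>x\<close> in the chart \<open>c\<close>. It depends only on the germ of \<open>f\<close> at \<open>x\<close>; it is taken
  within the image of the chart, so that it makes sense at boundary points.\<close>

definition chart_deriv ::
    "('m, 'n::finite) chart \<Rightarrow> 'm \<Rightarrow> ('m \<Rightarrow> 'b::real_normed_vector) \<Rightarrow> real ^ 'n \<Rightarrow> 'b" where
  "chart_deriv c x f = frechet_derivative (f \<circ> cinv c) (at (cmap c x) within cimg c)"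

text \<open>Given a smooth atlas, an orientation amounts to a positive subatlas; an oriented manifold is
  therefore given by a positive atlas.\<close>

definition oriented_atlas :: "('m, 'n::finite) chart set \<Rightarrow> bool" where
  "oriented_atlas \<A> \<longleftrightarrow>
     (\<forall>c\<in>\<A>. \<forall>c'\<in>\<A>. \<forall>x\<in>cdom c \<inter> cdom c'. 0 < det (matrix (chart_deriv c x (cmap c'))))"


section \<open>Tangent vectors\<close>

text \<open>A tangent vector at \<open>x\<close> is the family of its components in all charts around \<open>x\<close>, subject to the
  transformation law (and \<open>0\<close> at the irrelevant charts). Vector operations are those of the
  components.\<close>

type_synonym ('m, 'n) tangent = "('m, 'n) chart \<Rightarrow> real ^ 'n"

definition tangent_space :: "('m, 'n::finite) chart set \<Rightarrow> 'm \<Rightarrow> ('m, 'n) tangent set" where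
  "tangent_space \<A> x =
     {v. (\<forall>c\<in>\<A>. \<forall>c'\<in>\<A>. x \<in> cdom c \<inter> cdom c' \<longrightarrow> v c' = chart_deriv c x (cmap c') (v c)) \<and>
         (\<forall>c. \<not> (c \<in> \<A> \<and> x \<in> cdom c) \<longrightarrow> v c = 0)}"

text \<open>The tangent vector at \<open>x\<close> with components \<open>u\<close> in the chart \<open>c\<close>.\<close>

definition coord_vector ::
    "('m, 'n::finite) chart set \<Rightarrow> ('m, 'n) chart \<Rightarrow> 'm \<Rightarrow> real ^ 'n \<Rightarrow> ('m, 'n) tangent" where
  "coord_vector \<A> c x u =
     (\<lambda>c'. if c' \<in> \<A> \<and> x \<in> cdom c' then chart_deriv c x (cmap c') u else 0)"

definition differential ::
    "('m, 'n::finite) chart set \<Rightarrow> ('m \<Rightarrow> 'b::real_normed_vector) \<Rightarrow> 'm \<Rightarrow> ('m, 'n) tangent \<Rightarrow> 'b" where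
  "differential \<A> f x v = chart_deriv (chart_at \<A> x) x f (v (chart_at \<A> x))"

definition vector_field_on ::
    "('m, 'n::finite) chart set \<Rightarrow> 'm set \<Rightarrow> ('m \<Rightarrow> ('m, 'n) tangent) \<Rightarrow> bool" where
  "vector_field_on \<A> U Y \<longleftrightarrow>
     (\<forall>x\<in>U. Y x \<in> tangent_space \<A> x) \<and>
     (\<forall>c\<in>\<A>. smooth_on (cmap c ` (cdom c \<inter> U)) (\<lambda>y. Y (cinv c y) c))"

definition tangent_endomorphism ::
    "('m, 'n::finite) chart set \<Rightarrow> 'm \<Rightarrow> (('m, 'n) tangent \<Rightarrow> ('m, 'n) tangent) \<Rightarrow> bool" where
  "tangent_endomorphism \<A> x B \<longleftrightarrow>
     (\<forall>v\<in>tangent_space \<A> x. B v \<in> tangent_space \<A> x) \<and>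
     (\<forall>v\<in>tangent_space \<A> x. \<forall>w\<in>tangent_space \<A> x. \<forall>a b.
        B (\<lambda>c. a *\<^sub>R v c + b *\<^sub>R w c) = (\<lambda>c. a *\<^sub>R B v c + b *\<^sub>R B w c))"

text \<open>The trace of the matrix of \<open>B\<close> with respect to a coordinate frame.\<close>

definition tangent_trace ::
    "('m, 'n::finite) chart set \<Rightarrow> 'm \<Rightarrow> (('m, 'n) tangent \<Rightarrow> ('m, 'n) tangent) \<Rightarrow> real" where
  "tangent_trace \<A> x B =
     (let c = chart_at \<A> x in trace (matrix (\<lambda>u. B (coord_vector \<A> c x u) c)))"


section \<open>Riemannian metrics\<close>

type_synonym ('m, 'n) metric_field = "'m \<Rightarrow> ('m, 'n) tangent \<Rightarrow> ('m, 'n) tangent \<Rightarrow> real"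

definition riemannian_metric :: "('m, 'n::finite) chart set \<Rightarrow> ('m, 'n) metric_field \<Rightarrow> bool" where
  "riemannian_metric \<A> g \<longleftrightarrow>
     (\<forall>c\<in>\<A>.
        (\<forall>x\<in>cdom c.
           bilinear (\<lambda>u w. g x (coord_vector \<A> c x u) (coord_vector \<A> c x w)) \<and>
           (\<forall>v\<in>tangent_space \<A> x. \<forall>w\<in>tangent_space \<A> x. g x v w = g x w v) \<and>
           (\<forall>v\<in>tangent_space \<A> x. v \<noteq> (\<lambda>_. 0) \<longrightarrow> 0 < g x v v)) \<and>
        (\<forall>u w. smooth_on (cimg c)
           (\<lambda>y. g (cinv c y) (coord_vector \<A> c (cinv c y) u) (coord_vector \<A> c (cinv c y) w))))"

text \<open>Every point has a neighbourhood with a conformal embedding into Euclidean \<open>n\<close>-space. At boundary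
  points the image need not be (part of) a half-space.\<close>

definition conformally_flat ::
    "'m topology \<Rightarrow> ('m, 'n::finite) chart set \<Rightarrow> ('m, 'n) metric_field \<Rightarrow> bool" where
  "conformally_flat M \<A> g \<longleftrightarrow>
     (\<forall>x\<in>topspace M. \<exists>U (\<phi> :: 'm \<Rightarrow> real ^ 'n) (u :: 'm \<Rightarrow> real).
        openin M U \<and> x \<in> U \<and> smooth_map_on \<A> U \<phi> \<and> inj_on \<phi> U \<and> smooth_map_on \<A> U u \<and>
        (\<forall>y\<in>U. \<forall>v\<in>tangent_space \<A> y. \<forall>w\<in>tangent_space \<A> y.
           g y v w = exp (2 * u y) * (differential \<A> \<phi> y v \<bullet> differential \<A> \<phi> y w)))"


section \<open>Volume form and integration\<close>

text \<open>The Riemannian volume form of an oriented manifold: the form with the value \<open>1\<close> on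
  positively oriented orthonormal frames. The factor under the root is the Gram determinant.\<close>

definition volume_form ::
    "('m, 'n::finite) chart set \<Rightarrow> ('m, 'n) metric_field \<Rightarrow> 'm \<Rightarrow> ('n \<Rightarrow> ('m, 'n) tangent) \<Rightarrow> real" where
  "volume_form \<A> g x v =
     sgn (det (\<chi> i. v i (chart_at \<A> x))) * sqrt (det (\<chi> i j. g x (v i) (v j)))"

text \<open>A decomposition into finitely many disjoint Borel pieces, each relatively compact in the domain of
  a chart. On a compact manifold such decompositions exist, and by the change of variables formula
  the integral below does not depend on which one is used.\<close>

definition chart_partition ::
    "'m topology \<Rightarrow> ('m, 'n::finite) chart set \<Rightarrow> (('m, 'n) chart \<Rightarrow> 'm set) \<Rightarrow> bool" where
  "chart_partition M \<A> P \<longleftrightarrow>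
     finite {c\<in>\<A>. P c \<noteq> {}} \<and> disjoint_family_on P \<A> \<and> (\<Union>c\<in>\<A>. P c) = topspace M \<and>
     (\<forall>c\<in>\<A>. P c \<in> sigma_sets (topspace M) {U. openin M U} \<and>
        (\<exists>K. compactin M K \<and> P c \<subseteq> K \<and> K \<subseteq> cdom c))"

text \<open>The integral of an \<open>n\<close>-form over a compact manifold oriented by the atlas.\<close>

definition form_integral ::
    "'m topology \<Rightarrow> ('m, 'n::finite) chart set \<Rightarrow> ('m \<Rightarrow> ('n \<Rightarrow> ('m, 'n) tangent) \<Rightarrow> real) \<Rightarrow> real" where
  "form_integral M \<A> \<omega> =
     (let P = (SOME P. chart_partition M \<A> P) in
      \<Sum>c\<in>{c\<in>\<A>. P c \<noteq> {}}.
        LINT y : cmap c ` P c | lborel.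
          \<omega> (cinv c y) (\<lambda>i. coord_vector \<A> c (cinv c y) (axis i 1)))"

definition total_volume :: "'m topology \<Rightarrow> ('m, 'n::finite) chart set \<Rightarrow> ('m, 'n) metric_field \<Rightarrow> real" where
  "total_volume M \<A> g = form_integral M \<A> (volume_form \<A> g)"


section \<open>Immersions into Minkowski spacetime\<close>

text \<open>The first factor is the time coordinate; the second one has \<open>CARD('n option) = n + 1\<close> space
  coordinates, so the dimension is \<open>n + 2\<close>.\<close>

type_synonym 'n minkowski = "real \<times> (real ^ 'n option)"

definition lorentz :: "'n::finite minkowski \<Rightarrow> 'n minkowski \<Rightarrow> real" where
  "lorentz a b = - (fst a * fst b) + snd a \<bullet> snd b"

definition light_cone :: "'n::finite minkowski set" where
  "light_cone = {a. lorentz a a = 0}"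

definition immersion ::
    "'m topology \<Rightarrow> ('m, 'n::finite) chart set \<Rightarrow> ('m \<Rightarrow> 'n minkowski) \<Rightarrow> bool" where
  "immersion M \<A> f \<longleftrightarrow>
     smooth_map_on \<A> (topspace M) f \<and>
     (\<forall>x\<in>topspace M. inj_on (differential \<A> f x) (tangent_space \<A> x))"

definition induced_metric ::
    "('m, 'n::finite) chart set \<Rightarrow> ('m \<Rightarrow> 'n minkowski) \<Rightarrow> ('m, 'n) metric_field" where
  "induced_metric \<A> f x v w = lorentz (differential \<A> f x v) (differential \<A> f x w)"

definition spacelike_immersion ::
    "'m topology \<Rightarrow> ('m, 'n::finite) chart set \<Rightarrow> ('m \<Rightarrow> 'n minkowski) \<Rightarrow> bool" where
  "spacelike_immersion M \<A> f \<longleftrightarrow> immersion M \<A> f \<and> riemannian_metric \<A> (induced_metric \<A> f)"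

definition isometric_immersion_light_cone ::
    "'m topology \<Rightarrow> ('m, 'n::finite) chart set \<Rightarrow> ('m, 'n) metric_field \<Rightarrow> ('m \<Rightarrow> 'n minkowski) \<Rightarrow> bool" where
  "isometric_immersion_light_cone M \<A> g p \<longleftrightarrow>
     immersion M \<A> p \<and> p ` topspace M \<subseteq> light_cone \<and>
     (\<forall>x\<in>topspace M. \<forall>v\<in>tangent_space \<A> x. \<forall>w\<in>tangent_space \<A> x.
        induced_metric \<A> p x v w = g x v w)"

definition dual_map ::
    "'m topology \<Rightarrow> ('m, 'n::finite) chart set \<Rightarrow> ('m \<Rightarrow> 'n minkowski) \<Rightarrow> ('m \<Rightarrow> 'n minkowski) \<Rightarrow> bool" where
  "dual_map M \<A> p q \<longleftrightarrow>
     smooth_map_on \<A> (topspace M) q \<and> q ` topspace M \<subseteq> light_cone \<and>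
     (\<forall>x\<in>topspace M. lorentz (p x) (q x) = 1 \<and>
        (\<forall>v\<in>tangent_space \<A> x. lorentz (differential \<A> p x v) (q x) = 0))"

text \<open>The component of \<open>a\<close> normal to the immersion \<open>p\<close> at \<open>x\<close> (unique where \<open>p\<close> is spacelike).\<close>

definition normal_part ::
    "('m, 'n::finite) chart set \<Rightarrow> ('m \<Rightarrow> 'n minkowski) \<Rightarrow> 'm \<Rightarrow> 'n minkowski \<Rightarrow> 'n minkowski" where
  "normal_part \<A> p x a =
     (THE \<nu>. (\<forall>v\<in>tangent_space \<A> x. lorentz \<nu> (differential \<A> p x v) = 0) \<and>
             a - \<nu> \<in> differential \<A> p x ` tangent_space \<A> x)"

text \<open>The flat connection is the componentwise derivative: with \<open>W = dp(Z)\<close>, the derivative of \<open>W\<close> along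
  \<open>Y\<close> is \<open>dW(Y)\<close>.\<close>

definition second_fundamental_form ::
    "('m, 'n::finite) chart set \<Rightarrow> ('m \<Rightarrow> 'n minkowski) \<Rightarrow>
     ('m \<Rightarrow> ('m, 'n) tangent) \<Rightarrow> ('m \<Rightarrow> ('m, 'n) tangent) \<Rightarrow> 'm \<Rightarrow> 'n minkowski" where
  "second_fundamental_form \<A> p Y Z x =
     normal_part \<A> p x (differential \<A> (\<lambda>y. differential \<A> p y (Z y)) x (Y x))"

text \<open>\<open>Y\<close> and \<open>Z\<close> range over the smooth tangent vector fields on open subsets \<open>U\<close>, including
  \<open>U = topspace M\<close>.\<close>

definition shape_operator ::
    "'m topology \<Rightarrow> ('m, 'n::finite) chart set \<Rightarrow> ('m \<Rightarrow> 'n minkowski) \<Rightarrow> ('m \<Rightarrow> 'n minkowski) \<Rightarrow>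
     ('m \<Rightarrow> ('m, 'n) tangent \<Rightarrow> ('m, 'n) tangent) \<Rightarrow> bool" where
  "shape_operator M \<A> p q A \<longleftrightarrow>
     (\<forall>x\<in>topspace M. tangent_endomorphism \<A> x (A x)) \<and>
     (\<forall>U Y Z. openin M U \<and> vector_field_on \<A> U Y \<and> vector_field_on \<A> U Z \<longrightarrow>
        (\<forall>x\<in>U. lorentz (differential \<A> p x (A x (Y x))) (differential \<A> p x (Z x)) =
               lorentz (second_fundamental_form \<A> p Y Z x) (q x)))"


section \<open>Variations\<close>

definition variation ::
    "'m topology \<Rightarrow> ('m, 'n::finite) chart set \<Rightarrow> ('m \<Rightarrow> 'n minkowski) \<Rightarrow> real \<Rightarrow>
     (real \<Rightarrow> 'm \<Rightarrow> 'n minkowski) \<Rightarrow> bool" where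
  "variation M \<A> p \<epsilon> F \<longleftrightarrow>
     0 < \<epsilon> \<and>
     (\<forall>c\<in>\<A>. smooth_on ({-\<epsilon><..<\<epsilon>} \<times> cimg c) (\<lambda>(t, y). F t (cinv c y))) \<and>
     (\<forall>x\<in>topspace M. F 0 x = p x) \<and>
     (\<forall>t\<in>{-\<epsilon><..<\<epsilon>}. spacelike_immersion M \<A> (F t))"

definition fixed_boundary ::
    "('m, 'n::finite) chart set \<Rightarrow> ('m \<Rightarrow> 'n minkowski) \<Rightarrow> real \<Rightarrow> (real \<Rightarrow> 'm \<Rightarrow> 'n minkowski) \<Rightarrow> bool" where
  "fixed_boundary \<A> p \<epsilon> F \<longleftrightarrow>
     (\<forall>t\<in>{-\<epsilon><..<\<epsilon>}. \<forall>x\<in>manifold_boundary \<A>. F t x = p x)"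

definition variational_field :: "(real \<Rightarrow> 'm \<Rightarrow> 'n::finite minkowski) \<Rightarrow> 'm \<Rightarrow> 'n minkowski" where
  "variational_field F x = vector_derivative (\<lambda>t. F t x) (at 0)"

definition admissible ::
    "'m topology \<Rightarrow> ('m \<Rightarrow> 'n::finite minkowski) \<Rightarrow> (real \<Rightarrow> 'm \<Rightarrow> 'n minkowski) \<Rightarrow> bool" where
  "admissible M q F \<longleftrightarrow>
     (\<exists>\<phi> :: 'm \<Rightarrow> real. \<forall>x\<in>topspace M. variational_field F x = \<phi> x *\<^sub>R q x)"

end

theory Submission
  imports Defs
begin

text \<open>For an admissible variation the variational field \<open>X = \<phi> q\<close> is orthogonal to \<open>dp\<close>. Differentiating
  \<open>\<langle>X, \<partial>\<^sub>j p\<rangle> = 0\<close> and commuting \<open>\<partial>\<^sub>t\<close> with \<open>\<partial>\<^sub>i\<close> gives \<open>\<langle>\<partial>\<^sub>t \<partial>\<^sub>i F, \<partial>\<^sub>j p\<rangle> = - \<phi> \<langle>q, \<partial>\<^sub>i \<partial>\<^sub>j p\<rangle> =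
  - \<phi> \<langle>A \<partial>\<^sub>i, \<partial>\<^sub>j\<rangle>\<close> at \<open>t = 0\<close>, so the Gram matrix of the coordinate frame has derivative \<open>- 2 \<phi> a\<^sup>T G\<close>, where
  \<open>a\<close> is the matrix of \<open>A\<close>. By Jacobi's formula the volume density has derivative \<open>- \<phi> tr(A)\<close> times itself,
  pointwise; no integration by parts occurs. Since \<open>\<langle>p, q\<rangle> = 1\<close>, \<open>\<phi> = \<langle>X, p\<rangle>\<close>. It remains to differentiate under
  the integral sign, chart by chart, over relatively compact pieces.\<close>

section \<open>Calculus of smooth maps\<close>

text \<open>The obstacle is the boundary: there \<open>p\<close>, \<open>F\<close> and the
  transition maps are known on one side only, and derivatives are taken within relatively open
  subsets of the half-space. Such derivatives are unique because a short move in a positive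
  coordinate direction stays in the half-space, and they are computed by a smooth extension to an
  open set. Symmetry of second derivatives and the exchange of time and space derivatives are proved
  for the extension and carried back, so boundary and interior points are handled alike. The
  explicit derivative of the density is known only at \<open>t = 0\<close>, whereas domination of
  the difference quotients needs a bound for all nearby \<open>t\<close>. That bound comes from the
  Gram determinant, which is jointly smooth in time and space and positive for every
  \<open>t\<close> of the interval. The \<open>2\<close> in \<open>- 2 \<phi> a\<^sup>T G\<close>
  comes from the two slots of the Lorentz form, which contribute equally because \<open>A\<close> is
  self-adjoint; it cancels against the \<open>1/2\<close> from the square root.\<close>

lemma Ck_on_cong:
  assumes "open S" "\<And>x. x \<in> S \<Longrightarrow> f x = g x"
  shows "Ck_on k S f \<longleftrightarrow> Ck_on k S g"
proof -
  \<comment> \<open>Stated for arbitrary pairs because the induction passes to the derivatives.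
    Openness of \<open>S\<close> is essential: equality on \<open>S\<close> must persist near each
    point for the derivatives to agree.\<close>
  have imp: "Ck_on k S g'" if "Ck_on k S f'" "\<And>x. x \<in> S \<Longrightarrow> f' x = g' x" for f' g' :: "'a \<Rightarrow> 'b"
    using that
  proof (induction k arbitrary: f' g')
    case 0
    then show ?case by (metis Ck_on.simps(1) continuous_on_cong)
  next
    case (Suc k)
    have diff: "f' differentiable (at x)" if "x \<in> S" for x using Suc.prems that by simp
    have "g' differentiable (at x)" if "x \<in> S" for x
      using has_derivative_transform_within_open[OF diff[OF that, unfolded frechet_derivative_works] assms(1) that]
        Suc.prems(2) by (auto simp: differentiable_def)
    moreover have "frechet_derivative f' (at x) v = frechet_derivative g' (at x) v" if "x \<in> S" for x v
      using frechet_derivative_transform_within_open[of f' x S g'] diff[OF that] that assms(1) Suc.prems(2)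
      by simp
    ultimately show ?case
      using Suc.prems(1) Suc.IH[of "\<lambda>x. frechet_derivative f' (at x) v"
          "\<lambda>x. frechet_derivative g' (at x) v" for v] by simp
  qed
  show ?thesis using imp[of f g] imp[of g f] assms(2) by auto
qed

lemma Ck_on_transform:
  "open S \<Longrightarrow> Ck_on k S f \<Longrightarrow> (\<And>x. x \<in> S \<Longrightarrow> f x = g x) \<Longrightarrow> Ck_on k S g"
  using Ck_on_cong by blast

lemma Ck_on_subset: "Ck_on k S f \<Longrightarrow> T \<subseteq> S \<Longrightarrow> Ck_on k T f"
  by (induction k arbitrary: f) (auto intro: continuous_on_subset)

text \<open>The recursion for \<open>Suc k\<close> records differentiability and the regularity of
  the derivatives, not order \<open>k\<close> itself. That is recovered here; at the bottom,
  differentiability gives continuity.\<close>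

lemma Ck_on_Suc_imp: "Ck_on (Suc k) S f \<Longrightarrow> Ck_on k S f"
proof (induction k arbitrary: f)
  case 0
  then show ?case
    by (auto intro!: differentiable_imp_continuous_on simp: differentiable_on_def differentiable_at_withinI)
next
  case (Suc k)
  then show ?case by simp
qed

lemma Ck_on_const: "Ck_on k S (\<lambda>x. c)"
  by (induction k arbitrary: c) auto

lemma Ck_on_add:
  assumes "open S" "Ck_on k S f" "Ck_on k S g"
  shows "Ck_on k S (\<lambda>x. f x + g x)"
  using assms(2,3)
proof (induction k arbitrary: f g)
  case 0
  then show ?case by (simp add: continuous_on_add)
next
  case (Suc k)
  have "Ck_on k S (\<lambda>x. frechet_derivative (\<lambda>x. f x + g x) (at x) v)" for v
  proof -
    have "Ck_on k S (\<lambda>x. frechet_derivative f (at x) v + frechet_derivative g (at x) v)"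
      using Suc by auto
    moreover have "frechet_derivative f (at x) v + frechet_derivative g (at x) v =
        frechet_derivative (\<lambda>x. f x + g x) (at x) v" if "x \<in> S" for x
    proof -
      have "((\<lambda>x. f x + g x) has_derivative
          (\<lambda>v. frechet_derivative f (at x) v + frechet_derivative g (at x) v)) (at x)"
        using Suc.prems that by (intro has_derivative_add) (auto simp: frechet_derivative_works[THEN iffD1])
      from frechet_derivative_at[OF this] show ?thesis by metis
    qed
    ultimately show ?thesis by (rule Ck_on_transform[OF assms(1)])
  qed
  then show ?case using Suc.prems by auto
qed

lemma Ck_on_bounded_linear:
  assumes "open S" "bounded_linear L" "Ck_on k S f"
  shows "Ck_on k S (\<lambda>x. L (f x))"
  using assms(3)
proof (induction k arbitrary: f)
  case 0
  then show ?case using bounded_linear.continuous_on[OF assms(2)] by simp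
next
  case (Suc k)
  have *: "((\<lambda>x. L (f x)) has_derivative (\<lambda>v. L (frechet_derivative f (at x) v))) (at x)" if "x \<in> S" for x
    using Suc.prems that
    by (intro bounded_linear.has_derivative[OF assms(2)]) (auto simp: frechet_derivative_works[THEN iffD1])
  have "Ck_on k S (\<lambda>x. frechet_derivative (\<lambda>x. L (f x)) (at x) v)" for v
  proof -
    have "Ck_on k S (\<lambda>x. L (frechet_derivative f (at x) v))"
      using Suc by auto
    moreover have "L (frechet_derivative f (at x) v) =
        frechet_derivative (\<lambda>x. L (f x)) (at x) v" if "x \<in> S" for x
      using frechet_derivative_at[OF *[OF that]] by metis
    ultimately show ?thesis by (rule Ck_on_transform[OF assms(1)])
  qed
  then show ?case using * by (auto simp: differentiable_def)
qed

text \<open>By the product rule each summand of the derivative pairs a differentiated factor with an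
  undifferentiated one. The latter has one order to spare, which \<open>Ck_on_Suc_imp\<close> gives
  away so that the induction hypothesis fits.\<close>

lemma Ck_on_bounded_bilinear:
  assumes "open S" "bounded_bilinear b" "Ck_on k S f" "Ck_on k S g"
  shows "Ck_on k S (\<lambda>x. b (f x) (g x))"
  using assms(3,4)
proof (induction k arbitrary: f g)
  case 0
  then show ?case using bounded_bilinear.continuous_on[OF assms(2)] by simp
next
  case (Suc k)
  have *: "((\<lambda>x. b (f x) (g x)) has_derivative
      (\<lambda>v. b (f x) (frechet_derivative g (at x) v) + b (frechet_derivative f (at x) v) (g x))) (at x)"
    if "x \<in> S" for x
    using Suc.prems that
    by (intro bounded_bilinear.FDERIV[OF assms(2)]) (auto simp: frechet_derivative_works[THEN iffD1])
  have "Ck_on k S (\<lambda>x. frechet_derivative (\<lambda>x. b (f x) (g x)) (at x) v)" for v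
  proof -
    have "Ck_on k S (\<lambda>x. b (f x) (frechet_derivative g (at x) v) + b (frechet_derivative f (at x) v) (g x))"
      using Suc.prems Ck_on_Suc_imp[OF Suc.prems(1)] Ck_on_Suc_imp[OF Suc.prems(2)]
      by (intro Ck_on_add[OF assms(1)] Suc.IH) auto
    moreover have "b (f x) (frechet_derivative g (at x) v) + b (frechet_derivative f (at x) v) (g x) =
        frechet_derivative (\<lambda>x. b (f x) (g x)) (at x) v" if "x \<in> S" for x
      using frechet_derivative_at[OF *[OF that]] by metis
    ultimately show ?thesis by (rule Ck_on_transform[OF assms(1)])
  qed
  then show ?case using * by (auto simp: differentiable_def)
qed

lemma Ck_on_sum:
  assumes "open S" "\<And>i. i \<in> I \<Longrightarrow> Ck_on k S (f i)"
  shows "Ck_on k S (\<lambda>x. \<Sum>i\<in>I. f i x)"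
  using assms(2)
  by (induction I rule: infinite_finite_induct) (auto intro: Ck_on_const Ck_on_add[OF assms(1)])

text \<open>In the chain rule both the base point and the direction of the derivative of
  \<open>f\<close> vary with \<open>x\<close>, while \<open>Ck_on\<close> controls derivatives in
  fixed directions only. Expanding the direction in \<open>Basis\<close> turns the derivative into a
  sum of products covered by the induction hypothesis; hence the finite-dimensional middle
  space.\<close>

lemma Ck_on_compose:
  fixes g :: "'a::real_normed_vector \<Rightarrow> 'b::euclidean_space" and f :: "'b \<Rightarrow> 'c::real_normed_vector"
  assumes "open S" "Ck_on k T f" "Ck_on k S g" "g ` S \<subseteq> T"
  shows "Ck_on k S (\<lambda>x. f (g x))"
  using assms(2,3)
proof (induction k arbitrary: f)
  case 0
  then show ?case using assms(4) by (auto intro: continuous_on_compose2)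
next
  case (Suc k)
  have *: "((\<lambda>x. f (g x)) has_derivative
      (\<lambda>v. \<Sum>i\<in>Basis. (frechet_derivative g (at x) v \<bullet> i) *\<^sub>R frechet_derivative f (at (g x)) i)) (at x)"
    if "x \<in> S" for x
  proof -
    have df: "(f has_derivative frechet_derivative f (at (g x))) (at (g x))"
      using Suc.prems that assms(4) by (intro frechet_derivative_works[THEN iffD1]) auto
    have 1: "((\<lambda>x. f (g x)) has_derivative
        (\<lambda>v. frechet_derivative f (at (g x)) (frechet_derivative g (at x) v))) (at x)"
      using Suc.prems that
      by (intro has_derivative_compose[of g _ x UNIV f, OF _ df]) (auto intro: frechet_derivative_works[THEN iffD1])
    have 2: "frechet_derivative f (at (g x)) w =
        (\<Sum>i\<in>Basis. (w \<bullet> i) *\<^sub>R frechet_derivative f (at (g x)) i)" for w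
    proof -
      have "linear (frechet_derivative f (at (g x)))"
        using df by (rule has_derivative_linear)
      from linear_sum[OF this, of "\<lambda>i. (w \<bullet> i) *\<^sub>R i" Basis] linear_scale[OF this]
      show ?thesis by (simp add: euclidean_representation)
    qed
    show ?thesis by (rule has_derivative_eq_rhs[OF 1]) (rule ext, rule 2)
  qed
  have "Ck_on k S (\<lambda>x. frechet_derivative (\<lambda>x. f (g x)) (at x) v)" for v
  proof -
    have "Ck_on k S (\<lambda>x. \<Sum>i\<in>Basis. (frechet_derivative g (at x) v \<bullet> i) *\<^sub>R frechet_derivative f (at (g x)) i)"
      using Suc.prems Ck_on_Suc_imp[OF Suc.prems(2)]
      by (intro Ck_on_sum[OF assms(1)] Ck_on_bounded_bilinear[OF assms(1) bounded_bilinear_scaleR] Suc.IH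
          Ck_on_bounded_linear[OF assms(1) bounded_linear_inner_left]) auto
    moreover have "(\<Sum>i\<in>Basis. (frechet_derivative g (at x) v \<bullet> i) *\<^sub>R frechet_derivative f (at (g x)) i) =
        frechet_derivative (\<lambda>x. f (g x)) (at x) v" if "x \<in> S" for x
      using frechet_derivative_at[OF *[OF that]] by metis
    ultimately show ?thesis by (rule Ck_on_transform[OF assms(1)])
  qed
  then show ?case using * by (auto simp: differentiable_def)
qed

lemma Ck_on_self_bounded_linear: "bounded_linear L \<Longrightarrow> Ck_on k S L"
proof (induction k)
  case 0
  then show ?case by (simp add: linear_continuous_on)
next
  case (Suc k)
  have "(L has_derivative L) (at x)" for x
    by (rule bounded_linear_imp_has_derivative[OF Suc.prems])
  then have "L differentiable (at x)" "frechet_derivative L (at x) = L" for x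
    by (auto simp: differentiable_def frechet_derivative_at[symmetric])
  then show ?case
    by (simp add: Ck_on_const)
qed

text \<open>The witness in \<open>smooth_on\<close>, made explicit so that a single extension can
  serve for a map and for all of its partial derivatives.\<close>

definition smooth_extension ::
    "'a::real_normed_vector set \<Rightarrow> ('a \<Rightarrow> 'b::real_normed_vector) \<Rightarrow> 'a \<Rightarrow> 'a set \<Rightarrow> ('a \<Rightarrow> 'b) \<Rightarrow> bool" where
  "smooth_extension S f x V f' \<longleftrightarrow>
     open V \<and> x \<in> V \<and> (\<forall>k. Ck_on k V f') \<and> (\<forall>y\<in>V \<inter> S. f' y = f y)"

lemma smooth_on_iff_extension:
  "smooth_on S f \<longleftrightarrow> (\<forall>x\<in>S. \<exists>V f'. smooth_extension S f x V f')"
  by (simp only: smooth_on_def smooth_extension_def)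

lemma smooth_extensionD:
  assumes "smooth_extension S f x V f'"
  shows "open V" "x \<in> V" "Ck_on k V f'" "y \<in> V \<Longrightarrow> y \<in> S \<Longrightarrow> f' y = f y"
  using assms by (auto simp: smooth_extension_def)

lemma smooth_onE:
  assumes "smooth_on S f" "x \<in> S"
  obtains V f' where "smooth_extension S f x V f'"
  using assms by (auto simp: smooth_on_iff_extension)

lemma smooth_onI:
  assumes "\<And>x. x \<in> S \<Longrightarrow> \<exists>V f'. smooth_extension S f x V f'"
  shows "smooth_on S f"
  using assms by (simp add: smooth_on_iff_extension)

lemma smooth_on_transform:
  assumes "smooth_on S f" "T \<subseteq> S" "\<And>x. x \<in> T \<Longrightarrow> g x = f x"
  shows "smooth_on T g"
proof (rule smooth_onI)
  fix x assume "x \<in> T"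
  with assms(2) have "x \<in> S" by auto
  with assms(1) obtain V f' where "smooth_extension S f x V f'"
    by (rule smooth_onE)
  then have "smooth_extension T g x V f'"
    using assms(2,3) by (auto simp: smooth_extension_def)
  then show "\<exists>V f'. smooth_extension T g x V f'" by blast
qed

lemma smooth_on_cong: "smooth_on S f \<Longrightarrow> (\<And>x. x \<in> S \<Longrightarrow> g x = f x) \<Longrightarrow> smooth_on S g"
  by (rule smooth_on_transform) auto

lemma smooth_on_Ck: "(\<And>k. Ck_on k UNIV f) \<Longrightarrow> smooth_on S f"
  by (rule smooth_onI, rule exI[of _ UNIV], rule exI[of _ f]) (simp add: smooth_extension_def)

lemma smooth_on_const: "smooth_on S (\<lambda>x. c)"
  by (intro smooth_on_Ck Ck_on_const)

lemma smooth_on_self_bounded_linear: "bounded_linear L \<Longrightarrow> smooth_on S L"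
  by (intro smooth_on_Ck Ck_on_self_bounded_linear)

lemma smooth_on_bounded_bilinear:
  assumes "bounded_bilinear b" "smooth_on S f" "smooth_on S g"
  shows "smooth_on S (\<lambda>x. b (f x) (g x))"
proof (rule smooth_onI)
  fix x assume x: "x \<in> S"
  obtain V f' where V: "smooth_extension S f x V f'"
    using assms(2) x by (rule smooth_onE)
  obtain W g' where W: "smooth_extension S g x W g'"
    using assms(3) x by (rule smooth_onE)
  have "Ck_on k (V \<inter> W) (\<lambda>x. b (f' x) (g' x))" for k
    using smooth_extensionD(1,3)[OF V] smooth_extensionD(1,3)[OF W]
    by (intro Ck_on_bounded_bilinear[OF _ assms(1)]) (auto intro: Ck_on_subset)
  then have "smooth_extension S (\<lambda>x. b (f x) (g x)) x (V \<inter> W) (\<lambda>x. b (f' x) (g' x))"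
    using V W by (auto simp: smooth_extension_def)
  then show "\<exists>V h. smooth_extension S (\<lambda>x. b (f x) (g x)) x V h" by blast
qed

lemma smooth_on_add:
  assumes "smooth_on S f" "smooth_on S g"
  shows "smooth_on S (\<lambda>x. f x + g x)"
proof (rule smooth_onI)
  fix x assume x: "x \<in> S"
  obtain V f' where V: "smooth_extension S f x V f'"
    using assms(1) x by (rule smooth_onE)
  obtain W g' where W: "smooth_extension S g x W g'"
    using assms(2) x by (rule smooth_onE)
  have "Ck_on k (V \<inter> W) (\<lambda>x. f' x + g' x)" for k
    using smooth_extensionD(1,3)[OF V] smooth_extensionD(1,3)[OF W]
    by (intro Ck_on_add) (auto intro: Ck_on_subset)
  then have "smooth_extension S (\<lambda>x. f x + g x) x (V \<inter> W) (\<lambda>x. f' x + g' x)"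
    using V W by (auto simp: smooth_extension_def)
  then show "\<exists>V h. smooth_extension S (\<lambda>x. f x + g x) x V h" by blast
qed

lemma smooth_on_sum:
  assumes "\<And>i. i \<in> I \<Longrightarrow> smooth_on S (f i)"
  shows "smooth_on S (\<lambda>x. \<Sum>i\<in>I. f i x)"
  using assms
  by (induction I rule: infinite_finite_induct) (auto intro: smooth_on_const smooth_on_add)

lemma smooth_on_prod:
  fixes f :: "'i \<Rightarrow> 'a::real_normed_vector \<Rightarrow> real"
  assumes "\<And>i. i \<in> I \<Longrightarrow> smooth_on S (f i)"
  shows "smooth_on S (\<lambda>x. \<Prod>i\<in>I. f i x)"
  using assms
  by (induction I rule: infinite_finite_induct)
     (auto intro: smooth_on_const smooth_on_bounded_bilinear[OF bounded_bilinear_mult])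

lemma smooth_on_det:
  fixes f :: "'a::real_normed_vector \<Rightarrow> real^'n^'n"
  assumes "\<And>i j. smooth_on S (\<lambda>x. f x $ i $ j)"
  shows "smooth_on S (\<lambda>x. det (f x))"
  unfolding det_def
  by (intro smooth_on_sum smooth_on_prod smooth_on_bounded_bilinear[OF bounded_bilinear_mult]
      smooth_on_const assms)

lemma smooth_on_compose:
  fixes g :: "'a::real_normed_vector \<Rightarrow> 'b::euclidean_space"
  assumes "smooth_on T f" "smooth_on S g" "g ` S \<subseteq> T"
  shows "smooth_on S (\<lambda>x. f (g x))"
proof (rule smooth_onI)
  fix x assume x: "x \<in> S"
  obtain W g' where W: "smooth_extension S g x W g'"
    using assms(2) x by (rule smooth_onE)
  have "g x \<in> T" using assms(3) x by auto
  with assms(1) obtain V f' where V: "smooth_extension T f (g x) V f'"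
    by (rule smooth_onE)
  \<comment> \<open>Away from \<open>S\<close> the extension \<open>g'\<close> may leave the domain
    \<open>V\<close> of the outer extension, so its domain is cut down.\<close>
  define U where "U = W \<inter> g' -` V"
  have U: "open U" unfolding U_def
    using smooth_extensionD(3)[OF W, of 0] smooth_extensionD(1)[OF W] smooth_extensionD(1)[OF V]
    by (simp add: continuous_open_preimage)
  have "Ck_on k U (\<lambda>x. f' (g' x))" for k
  proof (rule Ck_on_compose[OF U])
    show "Ck_on k V f'" by (rule smooth_extensionD(3)[OF V])
    show "Ck_on k U g'" by (rule Ck_on_subset[OF smooth_extensionD(3)[OF W]]) (auto simp: U_def)
  qed (auto simp: U_def)
  moreover have "x \<in> U"
    using smooth_extensionD(2)[OF V] smooth_extensionD(2,4)[OF W] x by (simp add: U_def)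
  moreover have "f' (g' y) = f (g y)" if "y \<in> U" "y \<in> S" for y
    using smooth_extensionD(4)[OF V] smooth_extensionD(4)[OF W] that assms(3) by (auto simp: U_def)
  ultimately have "smooth_extension S (\<lambda>x. f (g x)) x U (\<lambda>x. f' (g' x))"
    using U by (simp add: smooth_extension_def)
  then show "\<exists>V h. smooth_extension S (\<lambda>x. f (g x)) x V h" by blast
qed

section \<open>Derivatives on relatively open subsets of the half-space\<close>

text \<open>Even at a boundary point, short segments in all positive coordinate directions stay in
  \<open>S\<close>: such a step can only increase a coordinate. These directions span the space, so
  they determine a linear map.\<close>

lemma rel_open_half_space_derivative_unique:
  fixes f :: "real ^ 'n::finite \<Rightarrow> 'b::real_normed_vector"
  assumes "openin (top_of_set half_space) S" "y \<in> S"
    and "(f has_derivative D) (at y within S)" "(f has_derivative D') (at y within S)"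
  shows "D = D'"
proof (rule frechet_derivative_unique_within[OF assms(3,4)])
  fix i :: "real ^ 'n" and e :: real
  assume i: "i \<in> Basis" and e: "e > 0"
  obtain O' where O': "open O'" "S = half_space \<inter> O'"
    using assms(1) by (auto simp: openin_open)
  then obtain r where r: "r > 0" "ball y r \<subseteq> O'"
    using assms(2) by (auto simp: open_contains_ball)
  define d where "d = min e r / 2"
  have d: "0 < d" "d < e" "d < r" using e r by (auto simp: d_def)
  obtain k where k: "i = axis k 1" using i by (auto simp: Basis_vec_def)
  have "y + d *\<^sub>R i \<in> half_space"
    using assms(2) d by (auto simp: O' half_space_def k axis_def)
  moreover have "y + d *\<^sub>R i \<in> O'"
    using r d i by (auto simp: dist_norm intro!: subsetD[OF r(2)])
  ultimately show "\<exists>d. 0 < \<bar>d\<bar> \<and> \<bar>d\<bar> < e \<and> y + d *\<^sub>R i \<in> S"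
    using d O' by (intro exI[of _ d]) auto
qed

lemma frechet_derivative_rel_open:
  fixes f :: "real ^ 'n::finite \<Rightarrow> 'b::real_normed_vector"
  assumes "openin (top_of_set half_space) S" "y \<in> S" "(f has_derivative D) (at y within S)"
  shows "frechet_derivative f (at y within S) = D"
  using rel_open_half_space_derivative_unique[OF assms(1,2) _ assms(3)] assms(3)
  by (metis differentiable_def frechet_derivative_works)

lemma smooth_extension_has_derivative:
  assumes "smooth_extension S f x V f'" "y \<in> V"
  shows "(f' has_derivative frechet_derivative f' (at y)) (at y)"
  using smooth_extensionD(3)[OF assms(1), of "Suc 0"] assms(2)
  by (simp add: frechet_derivative_works)

lemma smooth_extension_Ck_derivative:
  assumes "smooth_extension S f x V f'"
  shows "Ck_on k V (\<lambda>z. frechet_derivative f' (at z) v)"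
  using smooth_extensionD(3)[OF assms(1), of "Suc k"] by simp

lemma smooth_extension_has_derivative_within:
  assumes "smooth_extension S f x V f'" "y \<in> V" "y \<in> S"
  shows "(f has_derivative frechet_derivative f' (at y)) (at y within S)"
proof -
  have V: "open V" by (rule smooth_extensionD(1)[OF assms(1)])
  have "(f' has_derivative frechet_derivative f' (at y)) (at y within S)"
    by (rule has_derivative_at_withinI[OF smooth_extension_has_derivative[OF assms(1,2)]])
  moreover have "\<forall>\<^sub>F z in at y within S. f' z = f z"
    using eventually_at_topological V assms(2) smooth_extensionD(4)[OF assms(1)] by blast
  ultimately show ?thesis
    using smooth_extensionD(4)[OF assms] has_derivative_transform_eventually assms(3) by blast
qed

lemma smooth_on_imp_differentiable_within:
  assumes "smooth_on S f" "y \<in> S"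
  shows "f differentiable (at y within S)"
  using assms smooth_extension_has_derivative_within smooth_extensionD(2) differentiable_def
  by (metis smooth_onE)

lemma smooth_on_imp_continuous_on: "smooth_on S f \<Longrightarrow> continuous_on S f"
  by (simp add: differentiable_imp_continuous_on differentiable_on_def smooth_on_imp_differentiable_within)

lemma smooth_extension_has_derivative_space:
  assumes "smooth_extension (I \<times> S) f z V f'" "(t, y) \<in> V" "t \<in> I" "y \<in> S"
  shows "((\<lambda>y. f (t, y)) has_derivative (\<lambda>v. frechet_derivative f' (at (t, y)) (0, v))) (at y within S)"
proof -
  have "((\<lambda>y. (t, y)) has_derivative (\<lambda>v. (0, v))) (at y within S)"
    by (intro has_derivative_Pair has_derivative_const has_derivative_ident)
  then show ?thesis
    using has_derivative_subset[OF smooth_extension_has_derivative_within[OF assms(1,2)], of "Pair t ` S"]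
      has_derivative_in_compose[of "Pair t" "\<lambda>v. (0, v)" y S f "frechet_derivative f' (at (t, y))"] assms(3,4)
    by auto
qed

lemma smooth_extension_has_derivative_time:
  assumes "smooth_extension (I \<times> S) f z V f'" "(t, y) \<in> V" "t \<in> I" "y \<in> S" "open I"
  shows "((\<lambda>t. f (t, y)) has_vector_derivative frechet_derivative f' (at (t, y)) (1, 0)) (at t)"
proof -
  have l: "linear (frechet_derivative f' (at (t, y)))"
    using smooth_extension_has_derivative[OF assms(1,2)] has_derivative_linear by blast
  have "((\<lambda>t. (t, y)) has_derivative (\<lambda>v. (v, 0))) (at t within I)"
    by (intro has_derivative_Pair has_derivative_const has_derivative_ident)
  then have "((\<lambda>t. f (t, y)) has_derivative (\<lambda>v. frechet_derivative f' (at (t, y)) (v, 0))) (at t within I)"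
    using has_derivative_subset[OF smooth_extension_has_derivative_within[OF assms(1,2)], of "(\<lambda>t. (t, y)) ` I"]
      has_derivative_in_compose[of "\<lambda>t. (t, y)" "\<lambda>v. (v, 0)" t I f "frechet_derivative f' (at (t, y))"] assms(3,4)
    by auto
  moreover have "(\<lambda>v. frechet_derivative f' (at (t, y)) (v, 0)) =
      (\<lambda>v. v *\<^sub>R frechet_derivative f' (at (t, y)) (1, 0))"
  proof
    show "frechet_derivative f' (at (t, y)) (v, 0) = v *\<^sub>R frechet_derivative f' (at (t, y)) (1, 0)" for v
      using linear_scale[OF l, of v "(1, 0)"] by simp
  qed
  ultimately show ?thesis
    by (simp only: has_vector_derivative_def at_within_open[OF assms(3,5)])
qed

text \<open>The same \<open>f'\<close> that extends \<open>f\<close> also yields, by a partial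
  derivative, an extension of the space derivative. Together with the version for time, this reduces
  mixed derivatives within \<open>I \<times> S\<close> to second derivatives of one map on an open
  set.\<close>

lemma smooth_extension_space_derivative:
  fixes f :: "real \<times> (real ^ 'n::finite) \<Rightarrow> 'b::real_normed_vector"
  assumes "openin (top_of_set half_space) S" "smooth_extension (I \<times> S) f z V f'"
  shows "smooth_extension (I \<times> S) (\<lambda>(t, y). frechet_derivative (\<lambda>y. f (t, y)) (at y within S) v) z V
      (\<lambda>z. frechet_derivative f' (at z) (0, v))"
proof -
  have "frechet_derivative (\<lambda>y. f (t, y)) (at y within S) v = frechet_derivative f' (at (t, y)) (0, v)"
    if "(t, y) \<in> V" "t \<in> I" "y \<in> S" for t y
    using frechet_derivative_rel_open[OF assms(1) that(3) smooth_extension_has_derivative_space[OF assms(2) that]]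
    by simp
  then show ?thesis
    using smooth_extensionD(1,2)[OF assms(2)] smooth_extension_Ck_derivative[OF assms(2)]
    by (auto simp: smooth_extension_def)
qed

lemma smooth_on_space_derivative:
  fixes f :: "real \<times> (real ^ 'n::finite) \<Rightarrow> 'b::real_normed_vector"
  assumes "openin (top_of_set half_space) S" "smooth_on (I \<times> S) f"
  shows "smooth_on (I \<times> S) (\<lambda>(t, y). frechet_derivative (\<lambda>y. f (t, y)) (at y within S) v)"
  using assms smooth_extension_space_derivative[OF assms(1)] unfolding smooth_on_iff_extension by blast

lemma smooth_extension_time_derivative:
  fixes f :: "real \<times> 'a::real_normed_vector \<Rightarrow> 'b::real_normed_vector"
  assumes "open I" "smooth_extension (I \<times> S) f z V f'"
  shows "smooth_extension (I \<times> S) (\<lambda>(t, y). vector_derivative (\<lambda>t. f (t, y)) (at t)) z V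
      (\<lambda>z. frechet_derivative f' (at z) (1, 0))"
proof -
  have "vector_derivative (\<lambda>t. f (t, y)) (at t) = frechet_derivative f' (at (t, y)) (1, 0)"
    if "(t, y) \<in> V" "t \<in> I" "y \<in> S" for t y
    by (rule vector_derivative_at[OF smooth_extension_has_derivative_time[OF assms(2) that assms(1)]])
  then show ?thesis
    using smooth_extensionD(1,2)[OF assms(2)] smooth_extension_Ck_derivative[OF assms(2)]
    by (auto simp: smooth_extension_def)
qed

lemma smooth_on_time_derivative:
  fixes f :: "real \<times> 'a::real_normed_vector \<Rightarrow> 'b::real_normed_vector"
  assumes "open I" "smooth_on (I \<times> S) f"
  shows "smooth_on (I \<times> S) (\<lambda>(t, y). vector_derivative (\<lambda>t. f (t, y)) (at t))"
  using assms smooth_extension_time_derivative[OF assms(1)] unfolding smooth_on_iff_extension by blast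

lemma smooth_on_time_has_derivative:
  fixes f :: "real \<times> 'a::real_normed_vector \<Rightarrow> 'b::real_normed_vector"
  assumes "open I" "smooth_on (I \<times> S) f" "t \<in> I" "y \<in> S"
  shows "((\<lambda>t. f (t, y)) has_vector_derivative vector_derivative (\<lambda>t. f (t, y)) (at t)) (at t)"
proof -
  obtain V f' where V: "smooth_extension (I \<times> S) f (t, y) V f'"
    using assms by (auto elim: smooth_onE)
  show ?thesis
    using smooth_extension_has_derivative_time[OF V smooth_extensionD(2)[OF V] assms(3,4,1)]
    by (simp add: vector_derivative_at)
qed

lemma smooth_extension_rel_open_derivative:
  fixes f :: "real ^ 'n::finite \<Rightarrow> 'b::real_normed_vector"
  assumes "openin (top_of_set half_space) S" "smooth_extension S f z V f'"
  shows "smooth_extension S (\<lambda>y. frechet_derivative f (at y within S) v) z V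
      (\<lambda>z. frechet_derivative f' (at z) v)"
proof -
  have "frechet_derivative f (at y within S) v = frechet_derivative f' (at y) v"
    if "y \<in> V" "y \<in> S" for y
    using frechet_derivative_rel_open[OF assms(1) that(2) smooth_extension_has_derivative_within[OF assms(2) that]]
    by simp
  then show ?thesis
    using smooth_extensionD(1,2)[OF assms(2)] smooth_extension_Ck_derivative[OF assms(2)]
    by (auto simp: smooth_extension_def)
qed

lemma smooth_on_rel_open_derivative:
  fixes f :: "real ^ 'n::finite \<Rightarrow> 'b::real_normed_vector"
  assumes "openin (top_of_set half_space) S" "smooth_on S f"
  shows "smooth_on S (\<lambda>y. frechet_derivative f (at y within S) v)"
  using assms smooth_extension_rel_open_derivative[OF assms(1)] unfolding smooth_on_iff_extension by blast

lemma smooth_on_slice: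
  fixes f :: "real \<times> 'a::euclidean_space \<Rightarrow> 'b::real_normed_vector"
  assumes "smooth_on (I \<times> S) f" "t \<in> I"
  shows "smooth_on S (\<lambda>y. f (t, y))"
proof -
  have "smooth_on S (\<lambda>y. (t, 0) + (0, y))"
    by (intro smooth_on_add smooth_on_const smooth_on_self_bounded_linear bounded_linear_Pair
        bounded_linear_zero bounded_linear_ident)
  then have "smooth_on S (Pair t)" by (rule smooth_on_cong) simp
  from smooth_on_compose[OF assms(1) this] show ?thesis using assms(2) by auto
qed

section \<open>Symmetry of second derivatives\<close>

text \<open>The mean value theorem is applied twice: along \<open>u\<close> to a difference in the
  direction \<open>v\<close>, then along \<open>v\<close> to \<open>g' z u\<close>. The left-hand
  side of the resulting equation is symmetric in \<open>u\<close> and \<open>v\<close>, which is the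
  source of the symmetry of second derivatives.\<close>

lemma second_difference_mean_value:
  fixes g :: "'a::real_normed_vector \<Rightarrow> real"
  assumes h: "0 < h" and V: "\<And>s r. s \<in> {0..h} \<Longrightarrow> r \<in> {0..h} \<Longrightarrow> x + s *\<^sub>R u + r *\<^sub>R v \<in> V"
    and g: "\<And>z. z \<in> V \<Longrightarrow> (g has_derivative g' z) (at z)"
    and g': "\<And>z. z \<in> V \<Longrightarrow> ((\<lambda>z. g' z u) has_derivative G z) (at z)"
  obtains s r where "s \<in> {0<..<h}" "r \<in> {0<..<h}"
    "g (x + h *\<^sub>R u + h *\<^sub>R v) - g (x + h *\<^sub>R u) - g (x + h *\<^sub>R v) + g x = h * h * G (x + s *\<^sub>R u + r *\<^sub>R v) v"
proof -
  have d1: "DERIV (\<lambda>s. g (x + s *\<^sub>R u + r *\<^sub>R v)) s :> g' (x + s *\<^sub>R u + r *\<^sub>R v) u"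
    if "s \<in> {0..h}" "r \<in> {0..h}" for s r
  proof -
    have "((\<lambda>s. x + s *\<^sub>R u + r *\<^sub>R v) has_derivative (\<lambda>t. t *\<^sub>R u)) (at s)"
      by (auto intro!: derivative_eq_intros)
    from has_derivative_compose[OF this g[OF V[OF that]]]
    have "((\<lambda>s. g (x + s *\<^sub>R u + r *\<^sub>R v)) has_derivative (\<lambda>t. g' (x + s *\<^sub>R u + r *\<^sub>R v) (t *\<^sub>R u))) (at s)" .
    moreover have "g' (x + s *\<^sub>R u + r *\<^sub>R v) (t *\<^sub>R u) = g' (x + s *\<^sub>R u + r *\<^sub>R v) u * t" for t
      using linear_scale[OF has_derivative_linear[OF g[OF V[OF that]]]] by simp
    ultimately show ?thesis by (simp add: has_field_derivative_def)
  qed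
  have d2: "DERIV (\<lambda>r. g' (x + s *\<^sub>R u + r *\<^sub>R v) u) r :> G (x + s *\<^sub>R u + r *\<^sub>R v) v"
    if "s \<in> {0..h}" "r \<in> {0..h}" for s r
  proof -
    have "((\<lambda>r. x + s *\<^sub>R u + r *\<^sub>R v) has_derivative (\<lambda>t. t *\<^sub>R v)) (at r)"
      by (auto intro!: derivative_eq_intros)
    from has_derivative_compose[OF this g'[OF V[OF that]]]
    have "((\<lambda>r. g' (x + s *\<^sub>R u + r *\<^sub>R v) u) has_derivative (\<lambda>t. G (x + s *\<^sub>R u + r *\<^sub>R v) (t *\<^sub>R v))) (at r)" .
    moreover have "G (x + s *\<^sub>R u + r *\<^sub>R v) (t *\<^sub>R v) = G (x + s *\<^sub>R u + r *\<^sub>R v) v * t" for t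
      using linear_scale[OF has_derivative_linear[OF g'[OF V[OF that]]]] by simp
    ultimately show ?thesis by (simp add: has_field_derivative_def)
  qed
  have "\<exists>s>0. s < h \<and> (g (x + h *\<^sub>R u + h *\<^sub>R v) - g (x + h *\<^sub>R u + 0 *\<^sub>R v))
      - (g (x + 0 *\<^sub>R u + h *\<^sub>R v) - g (x + 0 *\<^sub>R u + 0 *\<^sub>R v))
      = (h - 0) * (g' (x + s *\<^sub>R u + h *\<^sub>R v) u - g' (x + s *\<^sub>R u + 0 *\<^sub>R v) u)"
    using h by (intro MVT2 DERIV_diff d1) auto
  then obtain s where s: "s > 0" "s < h" "g (x + h *\<^sub>R u + h *\<^sub>R v) - g (x + h *\<^sub>R u) - g (x + h *\<^sub>R v) + g x
      = h * (g' (x + s *\<^sub>R u + h *\<^sub>R v) u - g' (x + s *\<^sub>R u + 0 *\<^sub>R v) u)"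
    by auto
  have "\<exists>r>0. r < h \<and> g' (x + s *\<^sub>R u + h *\<^sub>R v) u - g' (x + s *\<^sub>R u + 0 *\<^sub>R v) u
      = (h - 0) * G (x + s *\<^sub>R u + r *\<^sub>R v) v"
    using h s by (intro MVT2 d2) auto
  then obtain r where "r > 0" "r < h" "g' (x + s *\<^sub>R u + h *\<^sub>R v) u - g' (x + s *\<^sub>R u + 0 *\<^sub>R v) u
      = h * G (x + s *\<^sub>R u + r *\<^sub>R v) v"
    by auto
  with s show ?thesis by (intro that[of s r]) auto
qed

lemma second_derivative_symmetric_real:
  fixes g :: "'a::real_normed_vector \<Rightarrow> real"
  assumes "open V" "x \<in> V"
    and g: "\<And>z. z \<in> V \<Longrightarrow> (g has_derivative g' z) (at z)"
    and u: "\<And>z. z \<in> V \<Longrightarrow> ((\<lambda>z. g' z u) has_derivative G z) (at z)"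
    and v: "\<And>z. z \<in> V \<Longrightarrow> ((\<lambda>z. g' z v) has_derivative H z) (at z)"
    and cu: "continuous_on V (\<lambda>z. G z v)" and cv: "continuous_on V (\<lambda>z. H z u)"
  shows "G x v = H x u"
proof (rule ccontr)
  assume neq: "G x v \<noteq> H x u"
  \<comment> \<open>Half the gap: a number within \<open>e\<close> of \<open>G x v\<close> cannot
    also be within \<open>e\<close> of \<open>H x u\<close>.\<close>
  define e where "e = dist (G x v) (H x u) / 2"
  have e: "e > 0" using neq by (simp add: e_def)
  have "\<forall>\<^sub>F z in nhds x. dist (G z v) (G x v) < e \<and> dist (H z u) (H x u) < e \<and> z \<in> V"
  proof (intro eventually_conj eventually_nhds_in_open[OF assms(1,2)])
    have lim: "(F \<longlongrightarrow> F x) (nhds x)" if "continuous_on V F" for F :: "'a \<Rightarrow> real"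
      using that assms(1,2) continuous_on_eq_continuous_at[OF assms(1)] tendsto_at_iff_tendsto_nhds[of F x]
      by (auto simp: isCont_def)
    show "\<forall>\<^sub>F z in nhds x. dist (G z v) (G x v) < e" by (rule tendstoD[OF lim[OF cu] e])
    show "\<forall>\<^sub>F z in nhds x. dist (H z u) (H x u) < e" by (rule tendstoD[OF lim[OF cv] e])
  qed
  then obtain d where d: "d > 0" "\<And>z. dist z x < d \<Longrightarrow> dist (G z v) (G x v) < e \<and> dist (H z u) (H x u) < e \<and> z \<in> V"
    by (auto simp: eventually_nhds_metric)
  \<comment> \<open>The whole parallelogram with sides \<open>h *\<^sub>R u\<close> and
    \<open>h *\<^sub>R v\<close> then lies in the ball of radius \<open>d\<close>; the summand
    \<open>1\<close> keeps the denominator positive and the estimate strict.\<close>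
  define h where "h = d / (norm u + norm v + 1)"
  have pos: "norm u + norm v + 1 > 0" by (simp add: add_nonneg_pos)
  have h: "h > 0" using d pos by (simp add: h_def)
  have small: "dist (x + s *\<^sub>R u + r *\<^sub>R v) x < d" if "s \<in> {0..h}" "r \<in> {0..h}" for s r
  proof -
    have "dist (x + s *\<^sub>R u + r *\<^sub>R v) x \<le> s * norm u + r * norm v"
      using norm_triangle_ineq[of "s *\<^sub>R u" "r *\<^sub>R v"] that by (simp add: dist_norm add.assoc)
    also have "\<dots> \<le> h * norm u + h * norm v"
      using that by (intro add_mono mult_right_mono) auto
    also have "\<dots> < h * (norm u + norm v + 1)" using h by (simp add: algebra_simps)
    also have "\<dots> = d" using pos by (simp add: h_def)
    finally show ?thesis .
  qed
  obtain s r where 1: "s \<in> {0<..<h}" "r \<in> {0<..<h}"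
    "g (x + h *\<^sub>R u + h *\<^sub>R v) - g (x + h *\<^sub>R u) - g (x + h *\<^sub>R v) + g x = h * h * G (x + s *\<^sub>R u + r *\<^sub>R v) v"
    using second_difference_mean_value[OF h _ g u, of x v V] d(2) small by (metis (no_types, lifting))
  have small': "x + s *\<^sub>R v + r *\<^sub>R u \<in> V" if "s \<in> {0..h}" "r \<in> {0..h}" for s r
    using d(2)[OF small[OF that(2,1)]] by (simp add: algebra_simps)
  \<comment> \<open>The same second difference with \<open>u\<close> and \<open>v\<close> exchanged;
    comparing the two expressions and dividing by \<open>h * h\<close> makes values of
    \<open>G\<close> and \<open>H\<close> near \<open>x\<close> coincide.\<close>
  obtain s' r' where 2: "s' \<in> {0<..<h}" "r' \<in> {0<..<h}"
    "g (x + h *\<^sub>R v + h *\<^sub>R u) - g (x + h *\<^sub>R v) - g (x + h *\<^sub>R u) + g x = h * h * H (x + s' *\<^sub>R v + r' *\<^sub>R u) u"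
    using second_difference_mean_value[OF h small' g v] by (metis (no_types, lifting))
  have "h * h * G (x + s *\<^sub>R u + r *\<^sub>R v) v = h * h * H (x + s' *\<^sub>R v + r' *\<^sub>R u) u"
    using 1(3) 2(3) by (simp add: algebra_simps)
  then have "G (x + s *\<^sub>R u + r *\<^sub>R v) v = H (x + r' *\<^sub>R u + s' *\<^sub>R v) u"
    using h by (simp add: algebra_simps)
  moreover have "dist (G (x + s *\<^sub>R u + r *\<^sub>R v) v) (G x v) < e"
    using d(2)[OF small[of s r]] 1 by auto
  moreover have "dist (H (x + r' *\<^sub>R u + s' *\<^sub>R v) u) (H x u) < e"
    using d(2)[OF small[of r' s']] 2 by auto
  ultimately show False
    using dist_triangle2[of "G x v" "H x u" "G (x + s *\<^sub>R u + r *\<^sub>R v) v"]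
    unfolding e_def by (simp add: dist_commute)
qed

lemma second_derivative_symmetric:
  fixes f :: "'a::real_normed_vector \<Rightarrow> 'b::euclidean_space"
  assumes "open V" "x \<in> V" "Ck_on 2 V f"
  shows "frechet_derivative (\<lambda>z. frechet_derivative f (at z) u) (at x) v =
         frechet_derivative (\<lambda>z. frechet_derivative f (at z) v) (at x) u"
proof (rule euclidean_eqI)
  fix b :: 'b assume "b \<in> Basis"
  have C: "Ck_on (Suc (Suc 0)) V f" using assms(3) by (simp add: numeral_2_eq_2)
  have 1: "(f has_derivative frechet_derivative f (at z)) (at z)" if "z \<in> V" for z
    using C that by (simp add: frechet_derivative_works)
  have 2: "((\<lambda>z. frechet_derivative f (at z) w) has_derivative
      frechet_derivative (\<lambda>z. frechet_derivative f (at z) w) (at z)) (at z)" if "z \<in> V" for z w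
    using C that by (simp add: frechet_derivative_works)
  have 3: "continuous_on V (\<lambda>z. frechet_derivative (\<lambda>z. frechet_derivative f (at z) w) (at z) w')" for w w'
    using C by simp
  show "frechet_derivative (\<lambda>z. frechet_derivative f (at z) u) (at x) v \<bullet> b =
        frechet_derivative (\<lambda>z. frechet_derivative f (at z) v) (at x) u \<bullet> b"
    by (rule second_derivative_symmetric_real[OF assms(1,2), of "\<lambda>z. f z \<bullet> b" "\<lambda>z w. frechet_derivative f (at z) w \<bullet> b"])
       (intro has_derivative_inner_left continuous_on_inner continuous_on_const 1 2 3; assumption)+
qed

lemma rel_open_second_derivative_symmetric:
  fixes f :: "real ^ 'n::finite \<Rightarrow> 'b::euclidean_space"
  assumes S: "openin (top_of_set half_space) S" and "smooth_on S f" "y \<in> S"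
  shows "frechet_derivative (\<lambda>y. frechet_derivative f (at y within S) u) (at y within S) v =
         frechet_derivative (\<lambda>y. frechet_derivative f (at y within S) v) (at y within S) u"
proof -
  obtain V f' where V: "smooth_extension S f y V f'"
    using assms(2,3) by (rule smooth_onE)
  note y = smooth_extensionD(2)[OF V]
  have "frechet_derivative (\<lambda>y. frechet_derivative f (at y within S) w) (at y within S) =
      frechet_derivative (\<lambda>z. frechet_derivative f' (at z) w) (at y)" for w
    by (rule frechet_derivative_rel_open[OF S assms(3)
          smooth_extension_has_derivative_within[OF smooth_extension_rel_open_derivative[OF S V] y assms(3)]])
  then show ?thesis
    using second_derivative_symmetric[OF smooth_extensionD(1)[OF V] y smooth_extensionD(3)[OF V]] by simp
qed

text \<open>Both sides are second derivatives at \<open>(t, y)\<close> of one smooth extension, in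
  the directions \<open>(0, u)\<close> and \<open>(1, 0)\<close> taken in either order.\<close>

lemma time_space_derivative_commute:
  fixes f :: "real \<times> (real ^ 'n::finite) \<Rightarrow> 'b::euclidean_space"
  assumes S: "openin (top_of_set half_space) S" and I: "open I"
    and "smooth_on (I \<times> S) f" and t: "t \<in> I" and y: "y \<in> S"
  shows "vector_derivative (\<lambda>t. frechet_derivative (\<lambda>y. f (t, y)) (at y within S) u) (at t) =
         frechet_derivative (\<lambda>y. vector_derivative (\<lambda>t. f (t, y)) (at t)) (at y within S) u"
proof -
  obtain V f' where V: "smooth_extension (I \<times> S) f (t, y) V f'"
    using assms by (auto elim: smooth_onE)
  note z = smooth_extensionD(2)[OF V]
  have "vector_derivative (\<lambda>t. frechet_derivative (\<lambda>y. f (t, y)) (at y within S) u) (at t) =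
      frechet_derivative (\<lambda>z. frechet_derivative f' (at z) (0, u)) (at (t, y)) (1, 0)"
    using vector_derivative_at[OF smooth_extension_has_derivative_time
        [OF smooth_extension_space_derivative[OF S V] z t y I]] by simp
  moreover have "frechet_derivative (\<lambda>y. vector_derivative (\<lambda>t. f (t, y)) (at t)) (at y within S) u =
      frechet_derivative (\<lambda>z. frechet_derivative f' (at z) (1, 0)) (at (t, y)) (0, u)"
    using frechet_derivative_rel_open[OF S y smooth_extension_has_derivative_space
        [OF smooth_extension_time_derivative[OF I V] z t y]] by simp
  ultimately show ?thesis
    using second_derivative_symmetric[OF smooth_extensionD(1)[OF V] z smooth_extensionD(3)[OF V]] by simp
qed

section \<open>Gram determinants and differentiation under the integral sign\<close>

text \<open>The segment from the identity to \<open>G\<close> consists of matrices with positive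
  quadratic form, hence of invertible ones. Its determinant starts at \<open>1\<close> and cannot
  change sign.\<close>

lemma det_pos_if_positive_definite:
  fixes G :: "real ^ 'n ^ 'n"
  assumes "\<And>x. x \<noteq> 0 \<Longrightarrow> 0 < x \<bullet> (G *v x)"
  shows "0 < det G"
proof (rule ccontr)
  define H where "H = (\<lambda>s::real. (1 - s) *\<^sub>R mat 1 + s *\<^sub>R G)"
  assume "\<not> 0 < det G"
  then have "det (H 1) \<le> 0" "0 \<le> det (H 0)" by (auto simp: H_def)
  moreover have "continuous_on {0..1} (\<lambda>s. det (H s))"
    unfolding det_def H_def by (intro continuous_intros)
  ultimately obtain s where s: "0 \<le> s" "s \<le> 1" "det (H s) = 0"
    using IVT2'[of "\<lambda>s. det (H s)" 1 0 0] by auto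
  have "x = 0" if "H s *v x = 0" for x
  proof (rule ccontr)
    assume x: "x \<noteq> 0"
    have "x \<bullet> (H s *v x) = (1 - s) * (x \<bullet> x) + s * (x \<bullet> (G *v x))"
      by (simp add: H_def matrix_vector_mult_add_rdistrib scaleR_matrix_vector_assoc[symmetric] inner_add_right)
    moreover have "0 < x \<bullet> x" using x by simp
    ultimately have "0 < x \<bullet> (H s *v x)"
      using s(1,2) assms[OF x] by (cases "s = 0") (auto intro!: add_nonneg_pos)
    then show False using that by simp
  qed
  then show False
    using s(3) matrix_left_invertible_ker[of "H s"] invertible_det_nz[of "H s"] invertible_left_inverse[of "H s"]
    by auto
qed

text \<open>Row \<open>i\<close> of \<open>B ** G\<close> is a combination of the rows of
  \<open>G\<close>. Expanding by linearity in that row, every term other than the one with row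
  \<open>i\<close> itself has a repeated row.\<close>

lemma det_replace_row_matrix_mult:
  fixes B G :: "real ^ 'n ^ 'n"
  shows "det (\<chi> k. if k = i then (B ** G) $ i else G $ k) = B $ i $ i * det G"
proof -
  have row: "(B ** G) $ i = (\<Sum>l\<in>UNIV. B $ i $ l *s G $ l)"
    by (simp add: vec_eq_iff matrix_matrix_mult_def)
  have "det (\<chi> k. if k = i then (B ** G) $ i else G $ k) =
      det (\<chi> k. if k = i then \<Sum>l\<in>UNIV. B $ i $ l *s G $ l else G $ k)"
    unfolding row ..
  also have "\<dots> = (\<Sum>l\<in>UNIV. det (\<chi> k. if k = i then B $ i $ l *s G $ l else G $ k))"
    by (rule det_linear_row_sum) simp
  also have "\<dots> = (\<Sum>l\<in>UNIV. B $ i $ l * det (\<chi> k. if k = i then G $ l else G $ k))"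
    by (intro sum.cong refl det_row_mul)
  also have "\<dots> = (\<Sum>l\<in>UNIV. if l = i then B $ i $ i * det G else 0)"
  proof (intro sum.cong refl)
    fix l
    show "B $ i $ l * det (\<chi> k. if k = i then G $ l else G $ k) = (if l = i then B $ i $ i * det G else 0)"
    proof (cases "l = i")
      case True
      then have "(\<chi> k. if k = i then G $ l else G $ k) = G" by (simp add: vec_eq_iff)
      then show ?thesis using True by simp
    next
      case False
      then have "det (\<chi> k. if k = i then G $ l else G $ k) = 0"
        by (intro det_identical_rows[of i l]) (auto simp: row_def vec_eq_iff)
      then show ?thesis using False by simp
    qed
  qed
  finally show ?thesis by simp
qed

text \<open>Jacobi's formula, with the derivative of \<open>G\<close> given in the factored form
  \<open>B ** G t0\<close> that the geometry provides. Differentiating the Leibniz expansion factor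
  by factor gives a sum of determinants with one row replaced, evaluated by
  \<open>det_replace_row_matrix_mult\<close>.\<close>

lemma det_has_real_derivative:
  fixes G :: "real \<Rightarrow> real ^ 'n ^ 'n" and B :: "real ^ 'n ^ 'n"
  assumes "\<And>i j. ((\<lambda>t. G t $ i $ j) has_real_derivative (B ** G t0) $ i $ j) (at t0)"
  shows "((\<lambda>t. det (G t)) has_real_derivative trace B * det (G t0)) (at t0)"
proof -
  let ?P = "{p. p permutes (UNIV :: 'n set)}"
  have "((\<lambda>t. det (G t)) has_real_derivative
      (\<Sum>p\<in>?P. of_int (sign p) * (\<Sum>i\<in>UNIV. (B ** G t0) $ i $ p i * (\<Prod>j\<in>UNIV - {i}. G t0 $ j $ p j)))) (at t0)"
    unfolding det_def
    by (intro DERIV_sum DERIV_cmult has_field_derivative_prod assms)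
  moreover have "(B ** G t0) $ i $ p i * (\<Prod>j\<in>UNIV - {i}. G t0 $ j $ p j) =
      (\<Prod>j\<in>UNIV. (\<chi> k. if k = i then (B ** G t0) $ i else G t0 $ k) $ j $ p j)" for p i
    by (subst (2) prod.remove[of _ i]) (auto intro!: prod.cong)
  ultimately have "((\<lambda>t. det (G t)) has_real_derivative
      (\<Sum>i\<in>UNIV. det (\<chi> k. if k = i then (B ** G t0) $ i else G t0 $ k))) (at t0)"
    unfolding det_def by (simp add: sum_distrib_left sum.swap[of _ UNIV])
  then show ?thesis
    by (simp add: det_replace_row_matrix_mult trace_def sum_distrib_right)
qed

text \<open>Dominated convergence for the difference quotients. The piece \<open>B\<close> is only
  Borel; the compact \<open>K\<close> around it supplies the finite measure and the uniform bound on
  \<open>\<rho>'\<close>, which the mean value inequality transfers to the quotients.\<close>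

lemma has_derivative_integral_compact:
  fixes \<rho> :: "real \<Rightarrow> 'a::euclidean_space \<Rightarrow> real"
  assumes "0 < \<epsilon>"
    and c: "\<And>t. t \<in> {-\<epsilon><..<\<epsilon>} \<Longrightarrow> continuous_on S (\<rho> t)"
    and c': "continuous_on ({-\<epsilon><..<\<epsilon>} \<times> S) (\<lambda>(t, y). \<rho>' t y)"
    and d: "\<And>t y. t \<in> {-\<epsilon><..<\<epsilon>} \<Longrightarrow> y \<in> S \<Longrightarrow> ((\<lambda>t. \<rho> t y) has_real_derivative \<rho>' t y) (at t)"
    and K: "compact K" "K \<subseteq> S" and B: "B \<in> sets borel" "B \<subseteq> K"
  shows "((\<lambda>t. LINT y : B | lborel. \<rho> t y) has_real_derivative (LINT y : B | lborel. \<rho>' 0 y)) (at 0)"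
proof -
  \<comment> \<open>The open time interval is shrunk to a compact one, on which
    \<open>\<rho>'\<close> is bounded over \<open>K\<close>.\<close>
  define e where "e = \<epsilon> / 2"
  have e: "0 < e" "e < \<epsilon>" using assms(1) by (auto simp: e_def)
  have "compact ((\<lambda>(t, y). \<rho>' t y) ` ({-e..e} \<times> K))"
    using e K by (intro compact_continuous_image continuous_on_subset[OF c'] compact_Times) auto
  then have "bounded ((\<lambda>(t, y). \<rho>' t y) ` ({-e..e} \<times> K))" by (rule compact_imp_bounded)
  then obtain C where C: "\<forall>z\<in>(\<lambda>(t, y). \<rho>' t y) ` ({-e..e} \<times> K). norm z \<le> C"
    unfolding bounded_iff by blast
  have C: "\<bar>\<rho>' t y\<bar> \<le> C" if "t \<in> {-e..e}" "y \<in> K" for t y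
    using bspec[OF C, of "\<rho>' t y"] that by force
  have fin: "emeasure lborel B < \<infinity>"
    using emeasure_mono[OF B(2), of lborel] emeasure_compact_finite[OF K(1)] B K(1)
    by (metis borel_compact le_less_trans sets_lborel infinity_ennreal_def)
  have meas: "(\<lambda>y. indicator B y *\<^sub>R f y) \<in> borel_measurable lborel" if "continuous_on S f" for f :: "'a \<Rightarrow> real"
    using borel_measurable_continuous_on_indicator[OF B(1) continuous_on_subset[OF that]] B K by auto
  have int: "integrable lborel (\<lambda>y. indicator B y *\<^sub>R f y)" if f: "continuous_on S f" for f :: "'a \<Rightarrow> real"
  proof -
    have "compact (f ` K)" using K by (intro compact_continuous_image continuous_on_subset[OF f]) auto
    then have "bounded (f ` K)" by (rule compact_imp_bounded)
    then obtain D where "\<forall>z\<in>f ` K. norm z \<le> D" unfolding bounded_iff by blast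
    then have "norm (f y) \<le> D" if "y \<in> B" for y using B that by auto
    then show ?thesis
      using B fin by (intro integrableI_bounded_set[OF _ meas[OF f], of B D]) auto
  qed
  have c0: "continuous_on S (\<rho>' 0)"
  proof -
    have "continuous_on S ((\<lambda>(t, y). \<rho>' t y) \<circ> Pair 0)"
      using assms(1) by (intro continuous_on_compose continuous_on_subset[OF c'] continuous_intros) auto
    then show ?thesis by (simp add: o_def)
  qed
  have lip: "\<bar>(\<rho> t y - \<rho> 0 y) / t\<bar> \<le> C" if "t \<in> {-e..e}" "t \<noteq> 0" "y \<in> K" for t y
  proof -
    have "norm (\<rho> t y - \<rho> 0 y) \<le> C * norm (t - 0)"
    proof (rule field_differentiable_bound[where S="{-e..e}" and f'="\<lambda>t. \<rho>' t y"])
      fix s assume "s \<in> {-e..e}"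
      then have "s \<in> {-\<epsilon><..<\<epsilon>}" "y \<in> S" using e K that by auto
      then show "((\<lambda>t. \<rho> t y) has_field_derivative \<rho>' s y) (at s within {-e..e})"
        by (rule has_field_derivative_at_within[OF d])
    next
      show "norm (\<rho>' s y) \<le> C" if "s \<in> {-e..e}" for s
        using C[OF that \<open>y \<in> K\<close>] by simp
    qed (use that e in simp_all)
    then show ?thesis using that by (simp add: divide_le_eq)
  qed
  have "((\<lambda>t. ((LINT y : B | lborel. \<rho> t y) - (LINT y : B | lborel. \<rho> 0 y)) / (t - 0))
      \<longlongrightarrow> (LINT y : B | lborel. \<rho>' 0 y)) (at 0)"
    unfolding tendsto_at_iff_sequentially
  proof (intro allI impI)
    fix X :: "nat \<Rightarrow> real" assume X0: "\<forall>i. X i \<in> UNIV - {0}" and X: "X \<longlonglongrightarrow> 0"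
    \<comment> \<open>The domination must hold for every index, so the sequence is shifted by
      \<open>N\<close> until it stays in the interval; \<open>LIMSEQ_offset\<close> undoes the
      shift.\<close>
    have "\<forall>\<^sub>F n in sequentially. X n \<in> {-e<..<e}"
      using X e by (intro topological_tendstoD) auto
    then obtain N where N: "\<And>n. n \<ge> N \<Longrightarrow> X n \<in> {-e<..<e}"
      by (auto simp: eventually_sequentially)
    have "(\<lambda>n. LINT y|lborel. indicator B y *\<^sub>R ((\<rho> (X (n + N)) y - \<rho> 0 y) / X (n + N))) \<longlonglongrightarrow>
        (LINT y|lborel. indicator B y *\<^sub>R \<rho>' 0 y)"
    proof (rule integral_dominated_convergence[where w="\<lambda>y. indicator B y *\<^sub>R C"])
      show "(\<lambda>y. indicator B y *\<^sub>R \<rho>' 0 y) \<in> borel_measurable lborel" by (rule meas[OF c0])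
      show "(\<lambda>y. indicator B y *\<^sub>R ((\<rho> (X (n + N)) y - \<rho> 0 y) / X (n + N))) \<in> borel_measurable lborel" for n
        using N[of "n + N"] e X0 by (intro meas continuous_intros c) auto
      show "integrable lborel (\<lambda>y. indicator B y *\<^sub>R C)" by (intro int continuous_intros)
      show "AE y in lborel. norm (indicator B y *\<^sub>R ((\<rho> (X (n + N)) y - \<rho> 0 y) / X (n + N))) \<le> indicator B y *\<^sub>R C" for n
        using lip[of "X (n + N)"] N[of "n + N"] X0 B by (intro AE_I2) (auto simp: indicator_def)
      show "AE y in lborel. (\<lambda>n. indicator B y *\<^sub>R ((\<rho> (X (n + N)) y - \<rho> 0 y) / X (n + N)))
          \<longlonglongrightarrow> indicator B y *\<^sub>R \<rho>' 0 y"
      proof (intro AE_I2)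
        fix y
        show "(\<lambda>n. indicator B y *\<^sub>R ((\<rho> (X (n + N)) y - \<rho> 0 y) / X (n + N))) \<longlonglongrightarrow> indicator B y *\<^sub>R \<rho>' 0 y"
        proof (cases "y \<in> B")
          case True
          then have "((\<lambda>t. (\<rho> t y - \<rho> 0 y) / (t - 0)) \<longlongrightarrow> \<rho>' 0 y) (at 0)"
            using d[of 0 y] B K assms(1) by (auto simp: has_field_derivative_iff)
          then have "((\<lambda>t. (\<rho> t y - \<rho> 0 y) / (t - 0)) \<circ> X) \<longlonglongrightarrow> \<rho>' 0 y"
            using X0 X unfolding tendsto_at_iff_sequentially by blast
          then have "(\<lambda>n. (\<rho> (X n) y - \<rho> 0 y) / X n) \<longlonglongrightarrow> \<rho>' 0 y" by (simp add: o_def)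
          from LIMSEQ_ignore_initial_segment[OF this, of N] show ?thesis using True by simp
        qed simp
      qed
    qed
    moreover have "(LINT y|lborel. indicator B y *\<^sub>R ((\<rho> (X (n + N)) y - \<rho> 0 y) / X (n + N))) =
        ((LINT y : B | lborel. \<rho> (X (n + N)) y) - (LINT y : B | lborel. \<rho> 0 y)) / (X (n + N) - 0)" for n
    proof -
      have "integrable lborel (\<lambda>y. indicator B y *\<^sub>R \<rho> (X (n + N)) y)" "integrable lborel (\<lambda>y. indicator B y *\<^sub>R \<rho> 0 y)"
        using N[of "n + N"] e assms(1) by (auto intro!: int c simp del: real_scaleR_def)
      moreover have "indicator B y *\<^sub>R ((\<rho> (X (n + N)) y - \<rho> 0 y) / X (n + N)) =
          (indicator B y *\<^sub>R \<rho> (X (n + N)) y - indicator B y *\<^sub>R \<rho> 0 y) / X (n + N)" for y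
        by (simp add: indicator_def)
      ultimately show ?thesis
        by (simp only: set_lebesgue_integral_def Bochner_Integration.integral_diff
            integral_divide_zero diff_zero)
    qed
    ultimately have "(\<lambda>n. ((LINT y : B | lborel. \<rho> (X (n + N)) y) - (LINT y : B | lborel. \<rho> 0 y)) / (X (n + N) - 0)) \<longlonglongrightarrow>
        (LINT y : B | lborel. \<rho>' 0 y)" by (simp only: set_lebesgue_integral_def)
    from LIMSEQ_offset[OF this] show "((\<lambda>t. ((LINT y : B | lborel. \<rho> t y) - (LINT y : B | lborel. \<rho> 0 y)) / (t - 0)) \<circ> X) \<longlonglongrightarrow>
        (LINT y : B | lborel. \<rho>' 0 y)" by (simp add: o_def)
  qed
  then show ?thesis by (simp add: has_field_derivative_iff)
qed

section \<open>Charts and tangent vectors\<close>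

text \<open>Near \<open>y\<close> the smaller set fills out all of \<open>H\<close>, hence all of
  \<open>S\<close>. Derivatives within a chart overlap and within the full chart image may thus be
  interchanged.\<close>

lemma at_within_rel_open_subset:
  assumes "openin (top_of_set H) T" "openin (top_of_set H) S" "T \<subseteq> S" "y \<in> T"
  shows "at y within T = at y within S"
proof -
  obtain W where W: "open W" "T = H \<inter> W" using assms(1) by (auto simp: openin_open)
  have "S \<subseteq> H" using assms(2) by (auto simp: openin_open)
  then show ?thesis
    using assms(3,4) W by (intro at_within_nhd[of y W]) auto
qed

locale smooth_manifold =
  fixes M :: "'m topology" and \<A> :: "('m, 'n::finite) chart set"
  assumes manifold: "smooth_manifold_with_boundary M \<A>"
begin

lemma chart: "c \<in> \<A> \<Longrightarrow> chart_of M c"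
  using manifold by (auto simp: smooth_manifold_with_boundary_def)

lemma openin_cdom: "c \<in> \<A> \<Longrightarrow> openin M (cdom c)"
  and openin_cimg: "c \<in> \<A> \<Longrightarrow> openin (top_of_set half_space) (cimg c)"
  and homeomorphic_map_cmap:
    "c \<in> \<A> \<Longrightarrow> homeomorphic_map (subtopology M (cdom c)) (top_of_set (cimg c)) (cmap c)"
  using chart by (auto simp: chart_of_def)

lemma cdom_subset: "c \<in> \<A> \<Longrightarrow> cdom c \<subseteq> topspace M"
  by (rule openin_subset[OF openin_cdom])

lemma in_topspace: "c \<in> \<A> \<Longrightarrow> x \<in> cdom c \<Longrightarrow> x \<in> topspace M"
  by (rule subsetD[OF cdom_subset])

lemma inj_on_cmap: "c \<in> \<A> \<Longrightarrow> inj_on (cmap c) (cdom c)"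
  using homeomorphic_imp_injective_map[OF homeomorphic_map_cmap] cdom_subset
  by (simp add: Int_absorb1)

lemma cinv_cmap: "c \<in> \<A> \<Longrightarrow> x \<in> cdom c \<Longrightarrow> cinv c (cmap c x) = x"
  by (simp add: cinv_def inj_on_cmap)

lemma cmap_cinv: "y \<in> cimg c \<Longrightarrow> cmap c (cinv c y) = y"
  by (simp add: cinv_def f_inv_into_f)

lemma cinv_in: "y \<in> cimg c \<Longrightarrow> cinv c y \<in> cdom c"
  by (simp add: cinv_def inv_into_into)

lemma openin_cmap_image:
  assumes "c \<in> \<A>" "openin M U" "U \<subseteq> cdom c"
  shows "openin (top_of_set half_space) (cmap c ` U)"
proof -
  have "openin (subtopology M (cdom c)) U"
    using assms by (simp add: openin_open_subtopology[OF openin_cdom])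
  then have "openin (top_of_set (cimg c)) (cmap c ` U)"
    using homeomorphic_imp_open_map[OF homeomorphic_map_cmap[OF assms(1)]] by (simp add: open_map_def)
  then show ?thesis
    using openin_trans openin_cimg[OF assms(1)] by blast
qed

lemma chart_overlap:
  assumes "c \<in> \<A>" "c' \<in> \<A>"
  shows "openin (top_of_set half_space) (cmap c ` (cdom c \<inter> cdom c'))"
    and "smooth_on (cmap c ` (cdom c \<inter> cdom c')) (cmap c' \<circ> cinv c)"
proof -
  show "openin (top_of_set half_space) (cmap c ` (cdom c \<inter> cdom c'))"
    using assms by (intro openin_cmap_image openin_Int openin_cdom) auto
  show "smooth_on (cmap c ` (cdom c \<inter> cdom c')) (cmap c' \<circ> cinv c)"
    using assms manifold by (simp add: smooth_manifold_with_boundary_def)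
qed

lemma at_within_chart_overlap:
  assumes "c \<in> \<A>" "c' \<in> \<A>" "y \<in> cmap c ` (cdom c \<inter> cdom c')"
  shows "at y within (cmap c ` (cdom c \<inter> cdom c')) = at y within cimg c"
  using assms
  by (intro at_within_rel_open_subset[OF chart_overlap(1)[OF assms(1,2)] openin_cimg[OF assms(1)]]) auto

lemma chart_deriv_eq:
  assumes "c \<in> \<A>" "x \<in> cdom c" "(f \<circ> cinv c has_derivative D) (at (cmap c x) within cimg c)"
  shows "chart_deriv c x f = D"
  using frechet_derivative_rel_open[OF openin_cimg[OF assms(1)] _ assms(3)] assms(2)
  by (simp add: chart_deriv_def)

lemma transition_has_derivative:
  assumes "c \<in> \<A>" "c' \<in> \<A>" "x \<in> cdom c" "x \<in> cdom c'"
  shows "(cmap c' \<circ> cinv c has_derivative chart_deriv c x (cmap c')) (at (cmap c x) within cimg c)"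
proof -
  have x: "cmap c x \<in> cmap c ` (cdom c \<inter> cdom c')" using assms by auto
  show ?thesis
    using smooth_on_imp_differentiable_within[OF chart_overlap(2)[OF assms(1,2)] x]
    by (simp add: chart_deriv_def at_within_chart_overlap[OF assms(1,2) x] frechet_derivative_works)
qed

lemma linear_chart_deriv:
  assumes "c \<in> \<A>" "c' \<in> \<A>" "x \<in> cdom c" "x \<in> cdom c'"
  shows "linear (chart_deriv c x (cmap c'))"
  using transition_has_derivative[OF assms] by (rule has_derivative_linear)

text \<open>The chain rule for \<open>f \<circ> cinv c' = (f \<circ> cinv c) \<circ> \<tau>\<close>.
  This identity holds only on the image \<open>T\<close> of the overlap, so the derivative is taken
  within \<open>T\<close> and then moved back to \<open>cimg c'\<close>.\<close>

lemma chart_change_has_derivative: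
  assumes "c \<in> \<A>" "c' \<in> \<A>" "x \<in> cdom c" "x \<in> cdom c'"
    and f: "(f \<circ> cinv c has_derivative D) (at (cmap c x) within cimg c)"
  shows "(f \<circ> cinv c' has_derivative (\<lambda>v. D (chart_deriv c' x (cmap c) v))) (at (cmap c' x) within cimg c')"
proof -
  define T where "T = cmap c' ` (cdom c' \<inter> cdom c)"
  define \<tau> where "\<tau> = cmap c \<circ> cinv c'"
  have xT: "cmap c' x \<in> T" using assms by (auto simp: T_def)
  have at: "at (cmap c' x) within T = at (cmap c' x) within cimg c'"
    unfolding T_def using at_within_chart_overlap[OF assms(2,1)] xT T_def by blast
  have "\<tau> ` T \<subseteq> cimg c" using assms(2) by (auto simp: T_def \<tau>_def cinv_cmap)
  moreover have "\<tau> (cmap c' x) = cmap c x" using assms by (simp add: \<tau>_def cinv_cmap)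
  ultimately have "(f \<circ> cinv c has_derivative D) (at (\<tau> (cmap c' x)) within \<tau> ` T)"
    using has_derivative_subset[OF f] by simp
  moreover have "(\<tau> has_derivative chart_deriv c' x (cmap c)) (at (cmap c' x) within T)"
    using transition_has_derivative[OF assms(2,1,4,3)] at by (simp add: \<tau>_def)
  ultimately have "((\<lambda>z. (f \<circ> cinv c) (\<tau> z)) has_derivative (\<lambda>v. D (chart_deriv c' x (cmap c) v))) (at (cmap c' x) within T)"
    by (rule has_derivative_in_compose[rotated])
  moreover have "(f \<circ> cinv c') z = (f \<circ> cinv c) (\<tau> z)" if "z \<in> T" for z
    using that assms(1,2) by (auto simp: T_def \<tau>_def cinv_cmap)
  ultimately have "(f \<circ> cinv c' has_derivative (\<lambda>v. D (chart_deriv c' x (cmap c) v))) (at (cmap c' x) within T)"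
    using xT by (rule_tac has_derivative_transform[OF xT])
  then show ?thesis by (simp add: at)
qed

lemma chart_deriv_trans:
  assumes "c \<in> \<A>" "c' \<in> \<A>" "c'' \<in> \<A>" "x \<in> cdom c" "x \<in> cdom c'" "x \<in> cdom c''"
  shows "chart_deriv c' x (cmap c'') (chart_deriv c x (cmap c') u) = chart_deriv c x (cmap c'') u"
  using chart_deriv_eq[OF assms(1,4) chart_change_has_derivative[OF assms(2,1,5,4)
    transition_has_derivative[OF assms(2,3,5,6)]]]
  by simp

lemma chart_deriv_self:
  assumes "c \<in> \<A>" "x \<in> cdom c"
  shows "chart_deriv c x (cmap c) u = u"
proof -
  have "((\<lambda>y. y) has_derivative (\<lambda>u. u)) (at (cmap c x) within cimg c)"
    by (rule has_derivative_ident)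
  then have "(cmap c \<circ> cinv c has_derivative (\<lambda>u. u)) (at (cmap c x) within cimg c)"
    by (rule has_derivative_transform[rotated 2]) (use assms in \<open>auto simp: cinv_cmap\<close>)
  from chart_deriv_eq[OF assms this] show ?thesis by simp
qed

lemma chart_at:
  assumes "x \<in> topspace M"
  shows "chart_at \<A> x \<in> \<A>" "x \<in> cdom (chart_at \<A> x)"
proof -
  have "\<exists>c. c \<in> \<A> \<and> x \<in> cdom c"
    using assms manifold unfolding smooth_manifold_with_boundary_def by blast
  from someI_ex[OF this] show "chart_at \<A> x \<in> \<A>" "x \<in> cdom (chart_at \<A> x)"
    by (auto simp: chart_at_def)
qed

section \<open>Tangent vectors, differentials, traces and volume forms in coordinates\<close>

lemma coord_vector_apply:
  "c' \<in> \<A> \<Longrightarrow> x \<in> cdom c' \<Longrightarrow> coord_vector \<A> c x u c' = chart_deriv c x (cmap c') u"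
  by (simp add: coord_vector_def)

lemma coord_vector_self:
  "c \<in> \<A> \<Longrightarrow> x \<in> cdom c \<Longrightarrow> coord_vector \<A> c x u c = u"
  by (simp add: coord_vector_apply chart_deriv_self)

lemma coord_vector_in_tangent_space:
  "c \<in> \<A> \<Longrightarrow> x \<in> cdom c \<Longrightarrow> coord_vector \<A> c x u \<in> tangent_space \<A> x"
  by (auto simp: tangent_space_def coord_vector_def chart_deriv_trans)

lemma tangent_vector_change:
  assumes "v \<in> tangent_space \<A> x" "c \<in> \<A>" "x \<in> cdom c" "c' \<in> \<A>" "x \<in> cdom c'"
  shows "v c' = chart_deriv c x (cmap c') (v c)"
  using assms unfolding tangent_space_def by blast

text \<open>One component determines the whole family: the transformation law fixes the components
  in charts around \<open>x\<close>, and both sides take the default \<open>0\<close> at all other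
  charts.\<close>

lemma tangent_vector_eq:
  assumes "v \<in> tangent_space \<A> x" "c \<in> \<A>" "x \<in> cdom c"
  shows "coord_vector \<A> c x (v c) = v"
proof
  fix c'
  show "coord_vector \<A> c x (v c) c' = v c'"
  proof (cases "c' \<in> \<A> \<and> x \<in> cdom c'")
    case True
    then have "v c' = chart_deriv c x (cmap c') (v c)"
      by (intro tangent_vector_change[OF assms]) auto
    then show ?thesis
      using True by (simp only: coord_vector_apply)
  next
    case False
    then have "v c' = 0" using assms(1) unfolding tangent_space_def by blast
    then show ?thesis by (simp only: coord_vector_def False if_False)
  qed
qed

lemma coord_vector_linear:
  assumes "c \<in> \<A>" "x \<in> cdom c"
  shows "coord_vector \<A> c x (a *\<^sub>R u + b *\<^sub>R w) =
    (\<lambda>c'. a *\<^sub>R coord_vector \<A> c x u c' + b *\<^sub>R coord_vector \<A> c x w c')"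
proof
  fix c'
  show "coord_vector \<A> c x (a *\<^sub>R u + b *\<^sub>R w) c' =
    a *\<^sub>R coord_vector \<A> c x u c' + b *\<^sub>R coord_vector \<A> c x w c'"
    using linear_chart_deriv[OF assms(1) _ assms(2), of c']
    by (auto simp: coord_vector_def linear_add linear_scale)
qed

text \<open>Independence of the choice made by \<open>chart_at\<close>: the transition derivative in
  the chart change cancels against the one in the transformation law of \<open>v\<close>.\<close>

lemma differential_eq:
  assumes "v \<in> tangent_space \<A> x" "c \<in> \<A>" "x \<in> cdom c"
    and f: "(f \<circ> cinv c has_derivative D) (at (cmap c x) within cimg c)"
  shows "differential \<A> f x v = D (v c)"
proof -
  have x: "x \<in> topspace M" by (rule in_topspace[OF assms(2,3)])
  note c0 = chart_at[OF x]
  have "chart_deriv (chart_at \<A> x) x f = (\<lambda>v. D (chart_deriv (chart_at \<A> x) x (cmap c) v))"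
    by (rule chart_deriv_eq[OF c0 chart_change_has_derivative[OF assms(2) c0(1) assms(3) c0(2) f]])
  then show ?thesis
    using tangent_vector_change[OF assms(1) c0 assms(2,3)] by (simp add: differential_def)
qed

lemma differential_coord_vector:
  assumes "c \<in> \<A>" "x \<in> cdom c" "(f \<circ> cinv c has_derivative D) (at (cmap c x) within cimg c)"
  shows "differential \<A> f x (coord_vector \<A> c x u) = D u"
  using differential_eq[OF coord_vector_in_tangent_space[OF assms(1,2)] assms]
  by (simp add: coord_vector_self[OF assms(1,2)])

text \<open>Makes coordinate fields available as test fields for \<open>shape_operator\<close>. In
  another chart the components are derivatives of the transition from \<open>c\<close>, evaluated at
  the \<open>c\<close>-coordinates of the point; smoothness in \<open>c'\<close>-coordinates
  therefore requires composing with the reverse transition.\<close>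

lemma coord_vector_field:
  assumes c: "c \<in> \<A>"
  shows "vector_field_on \<A> (cdom c) (\<lambda>x. coord_vector \<A> c x u)"
  unfolding vector_field_on_def
proof (intro conjI ballI)
  fix c' assume c': "c' \<in> \<A>"
  define T where "T = cmap c ` (cdom c \<inter> cdom c')"
  have 1: "smooth_on T (\<lambda>z. frechet_derivative (cmap c' \<circ> cinv c) (at z within T) u)"
    unfolding T_def by (rule smooth_on_rel_open_derivative[OF chart_overlap[OF c c']])
  have 2: "(cmap c \<circ> cinv c') ` (cmap c' ` (cdom c' \<inter> cdom c)) \<subseteq> T"
    using c' by (auto simp: T_def cinv_cmap)
  have "smooth_on (cmap c' ` (cdom c' \<inter> cdom c))
      (\<lambda>y. frechet_derivative (cmap c' \<circ> cinv c) (at ((cmap c \<circ> cinv c') y) within T) u)"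
    by (rule smooth_on_compose[OF 1 chart_overlap(2)[OF c' c] 2])
  then show "smooth_on (cmap c' ` (cdom c' \<inter> cdom c)) (\<lambda>y. coord_vector \<A> c (cinv c' y) u c')"
  proof (rule smooth_on_cong)
    fix y assume "y \<in> cmap c' ` (cdom c' \<inter> cdom c)"
    then obtain x where x: "x \<in> cdom c'" "x \<in> cdom c" "y = cmap c' x" by auto
    then have "at (cmap c x) within T = at (cmap c x) within cimg c"
      unfolding T_def by (intro at_within_chart_overlap c c') auto
    then show "coord_vector \<A> c (cinv c' y) u c' =
        frechet_derivative (cmap c' \<circ> cinv c) (at ((cmap c \<circ> cinv c') y) within T) u"
      using x c' by (simp add: cinv_cmap coord_vector_apply chart_deriv_def)
  qed
qed (use c coord_vector_in_tangent_space in auto)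

lemma linear_tangent_endomorphism:
  assumes "tangent_endomorphism \<A> x B" "c \<in> \<A>" "x \<in> cdom c"
  shows "linear (\<lambda>u. B (coord_vector \<A> c x u) c)"
proof -
  have *: "B (coord_vector \<A> c x (a *\<^sub>R u + b *\<^sub>R w)) c =
      a *\<^sub>R B (coord_vector \<A> c x u) c + b *\<^sub>R B (coord_vector \<A> c x w) c" for a b u w
  proof -
    have "B (\<lambda>c'. a *\<^sub>R coord_vector \<A> c x u c' + b *\<^sub>R coord_vector \<A> c x w c') =
        (\<lambda>c'. a *\<^sub>R B (coord_vector \<A> c x u) c' + b *\<^sub>R B (coord_vector \<A> c x w) c')"
      using assms(1) coord_vector_in_tangent_space[OF assms(2,3)] unfolding tangent_endomorphism_def by blast
    then show ?thesis by (simp only: coord_vector_linear[OF assms(2,3)])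
  qed
  show ?thesis
    using *[of 1 _ 1] *[of _ _ 0 0] by (intro linearI) auto
qed

text \<open>A change of chart conjugates the matrix by the mutually inverse Jacobians
  \<open>J\<close> and \<open>K\<close>, and the trace is cyclic.\<close>

lemma tangent_trace_eq:
  assumes "tangent_endomorphism \<A> x B" "c \<in> \<A>" "x \<in> cdom c"
  shows "tangent_trace \<A> x B = trace (matrix (\<lambda>u. B (coord_vector \<A> c x u) c))"
proof -
  have "x \<in> topspace M" by (rule in_topspace[OF assms(2,3)])
  note c0 = chart_at[OF this]
  define b where "b = (\<lambda>u. B (coord_vector \<A> c x u) c)"
  define J where "J = chart_deriv (chart_at \<A> x) x (cmap c)"
  define K where "K = chart_deriv c x (cmap (chart_at \<A> x))"
  have lin: "linear b" "linear J" "linear K"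
    using linear_tangent_endomorphism[OF assms] linear_chart_deriv c0 assms(2,3)
    by (auto simp: b_def J_def K_def)
  have "coord_vector \<A> (chart_at \<A> x) x u = coord_vector \<A> c x (J u)" for u
    using tangent_vector_eq[OF coord_vector_in_tangent_space[OF c0] assms(2,3), of u] assms(2,3)
    by (simp add: coord_vector_apply J_def)
  moreover have "B (coord_vector \<A> c x u) (chart_at \<A> x) = K (b u)" for u
  proof -
    have "B (coord_vector \<A> c x u) \<in> tangent_space \<A> x"
      using assms(1) coord_vector_in_tangent_space[OF assms(2,3)] unfolding tangent_endomorphism_def by blast
    from tangent_vector_change[OF this assms(2,3) c0] show ?thesis by (simp only: b_def K_def)
  qed
  ultimately have "tangent_trace \<A> x B = trace (matrix (K \<circ> (b \<circ> J)))"
    by (simp add: tangent_trace_def Let_def o_def)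
  also have "\<dots> = trace (matrix K ** (matrix b ** matrix J))"
    by (simp add: matrix_compose linear_compose lin)
  also have "\<dots> = trace (matrix b ** (matrix J ** matrix K))"
    by (metis trace_mul_sym matrix_mul_assoc)
  also have "matrix J ** matrix K = mat 1"
  proof -
    have "J \<circ> K = id"
      using assms c0 by (auto simp: J_def K_def chart_deriv_trans chart_deriv_self)
    then have "matrix (J \<circ> K) = mat 1" by (simp only: matrix_id_mat_1)
    then show ?thesis by (simp add: matrix_compose lin)
  qed
  finally show ?thesis by (simp add: b_def)
qed

text \<open>In an oriented atlas the frame of \<open>c\<close> has positive determinant in the
  reference chart, so the sign factor is \<open>1\<close>.\<close>

lemma volume_form_coord_frame:
  assumes "oriented_atlas \<A>" "c \<in> \<A>" "x \<in> cdom c"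
  shows "volume_form \<A> g x (\<lambda>i. coord_vector \<A> c x (axis i 1)) =
    sqrt (det (\<chi> i j. g x (coord_vector \<A> c x (axis i 1)) (coord_vector \<A> c x (axis j 1))))"
proof -
  have "x \<in> topspace M" by (rule in_topspace[OF assms(2,3)])
  note c0 = chart_at[OF this]
  have "(\<chi> i. coord_vector \<A> c x (axis i 1) (chart_at \<A> x)) =
      transpose (matrix (chart_deriv c x (cmap (chart_at \<A> x))))"
    by (simp add: vec_eq_iff coord_vector_apply[OF c0] transpose_def matrix_def)
  moreover have "0 < det (matrix (chart_deriv c x (cmap (chart_at \<A> x))))"
    using assms c0 by (auto simp: oriented_atlas_def)
  ultimately show ?thesis by (simp add: volume_form_def det_transpose)
qed

lemma gram_quadratic_form:
  assumes "bilinear (\<lambda>u w. g x (coord_vector \<A> c x u) (coord_vector \<A> c x w))"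
  shows "u \<bullet> ((\<chi> i j. g x (coord_vector \<A> c x (axis i 1)) (coord_vector \<A> c x (axis j 1))) *v w) =
    g x (coord_vector \<A> c x u) (coord_vector \<A> c x w)"
proof -
  define b where "b = (\<lambda>u w. g x (coord_vector \<A> c x u) (coord_vector \<A> c x w))"
  have b: "bilinear b" using assms by (simp add: b_def)
  have "b u w = b (\<Sum>i\<in>UNIV. u $ i *\<^sub>R axis i 1) (\<Sum>j\<in>UNIV. w $ j *\<^sub>R axis j 1)"
    by (metis basis_expansion scalar_mult_eq_scaleR)
  also have "\<dots> = (\<Sum>(i, j)\<in>UNIV \<times> UNIV. b (u $ i *\<^sub>R axis i 1) (w $ j *\<^sub>R axis j 1))"
    by (rule bilinear_sum[OF b])
  also have "\<dots> = (\<Sum>i\<in>UNIV. \<Sum>j\<in>UNIV. u $ i * (b (axis i 1) (axis j 1) * w $ j))"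
    by (simp add: sum.cartesian_product bilinear_lmul[OF b] bilinear_rmul[OF b] ac_simps)
  finally show ?thesis
    by (simp add: b_def inner_vec_def matrix_vector_mult_def sum_distrib_left)
qed

lemma gram_pos:
  assumes "riemannian_metric \<A> g" "c \<in> \<A>" "x \<in> cdom c" "u \<noteq> 0"
  shows "0 < g x (coord_vector \<A> c x u) (coord_vector \<A> c x u)"
proof -
  have "coord_vector \<A> c x u \<noteq> (\<lambda>_. 0)"
    using coord_vector_self[OF assms(2,3), of u] assms(4) by auto
  then show ?thesis
    using assms coord_vector_in_tangent_space[OF assms(2,3)] by (auto simp: riemannian_metric_def)
qed

section \<open>Borel and compact chart images; existence of chart partitions\<close>

lemma continuous_map_cinv:
  assumes "c \<in> \<A>"
  shows "continuous_map (top_of_set (cimg c)) M (cinv c)"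
proof -
  obtain h where h: "homeomorphic_maps (subtopology M (cdom c)) (top_of_set (cimg c)) (cmap c) h"
    using homeomorphic_map_cmap[OF assms] by (auto simp: homeomorphic_map_maps)
  have "h y = cinv c y" if "y \<in> cimg c" for y
    using that h cdom_subset[OF assms] assms by (auto simp: homeomorphic_maps_def cinv_cmap)
  moreover have "continuous_map (top_of_set (cimg c)) (subtopology M (cdom c)) h"
    using h by (simp add: homeomorphic_maps_def)
  ultimately have "continuous_map (top_of_set (cimg c)) (subtopology M (cdom c)) (cinv c)"
    by (auto intro: continuous_map_eq)
  then show ?thesis by (rule continuous_map_into_fulltopology)
qed

lemma cimg_borel:
  assumes "c \<in> \<A>"
  shows "cimg c \<in> sets borel"
proof -
  obtain W where "open W" "cimg c = half_space \<inter> W"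
    using openin_cimg[OF assms] by (auto simp: openin_open)
  moreover have "closed (half_space :: (real ^ 'n) set)"
    unfolding half_space_def by (intro closed_Collect_le continuous_intros)
  ultimately show ?thesis by (simp add: borel_closed borel_open sets.Int)
qed

text \<open>On \<open>cdom c\<close> the image is the preimage under the continuous
  \<open>cinv c\<close>, and preimages respect complements and unions. The induction runs over
  preimages because sets arising in the generation of \<open>P\<close> may leave the chart
  domain.\<close>

lemma cmap_image_borel:
  assumes c: "c \<in> \<A>" and P: "P \<in> sigma_sets (topspace M) {U. openin M U}" "P \<subseteq> cdom c"
  shows "cmap c ` P \<in> sets borel"
proof -
  have "{y \<in> cimg c. cinv c y \<in> P} \<in> sets borel"
    using P(1)
  proof induction
    case (Basic U)
    then have "openin (top_of_set (cimg c)) {y \<in> cimg c. cinv c y \<in> U}"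
      using openin_continuous_map_preimage[OF continuous_map_cinv[OF c], of U] by simp
    then obtain W where "open W" "{y \<in> cimg c. cinv c y \<in> U} = cimg c \<inter> W"
      by (auto simp: openin_open)
    then show ?case using cimg_borel[OF c] by (simp add: borel_open sets.Int)
  next
    case Empty
    then show ?case by simp
  next
    case (Compl Q)
    have "{y \<in> cimg c. cinv c y \<in> topspace M - Q} = cimg c - {y \<in> cimg c. cinv c y \<in> Q}"
      using in_topspace[OF c cinv_in] by auto
    then show ?case using cimg_borel[OF c] Compl by (simp add: sets.Diff)
  next
    case (Union Q)
    have "{y \<in> cimg c. cinv c y \<in> (\<Union>i. Q i)} = (\<Union>i. {y \<in> cimg c. cinv c y \<in> Q i})" by blast
    then show ?case using Union by (simp add: sets.countable_UN)
  qed
  moreover have "cmap c ` P = {y \<in> cimg c. cinv c y \<in> P}"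
    using P(2) c cmap_cinv by (auto simp: cinv_cmap intro!: image_eqI)
  ultimately show ?thesis by simp
qed

lemma compact_cmap_image:
  assumes "c \<in> \<A>" "compactin M K" "K \<subseteq> cdom c"
  shows "compact (cmap c ` K)"
proof -
  have "compactin (subtopology M (cdom c)) K" using assms by (simp add: compactin_subtopology)
  then have "compactin (top_of_set (cimg c)) (cmap c ` K)"
    by (rule image_compactin) (rule homeomorphic_imp_continuous_map[OF homeomorphic_map_cmap[OF assms(1)]])
  then show ?thesis by (simp add: compactin_subtopology)
qed

text \<open>A compact Hausdorff space is regular, so a closed neighbourhood fits inside a chart
  domain, and closed sets are compact here.\<close>

lemma compact_chart_neighbourhood:
  assumes "compact_space M" "x \<in> topspace M"
  shows "\<exists>c V K. c \<in> \<A> \<and> openin M V \<and> compactin M K \<and> x \<in> V \<and> V \<subseteq> K \<and> K \<subseteq> cdom c"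
proof -
  have "Hausdorff_space M" using manifold by (simp add: smooth_manifold_with_boundary_def)
  with assms have "neighbourhood_base_of (closedin M) M"
    by (simp add: compact_Hausdorff_imp_regular_space neighbourhood_base_of_closedin)
  then obtain V K where "openin M V" "closedin M K" "x \<in> V" "V \<subseteq> K" "K \<subseteq> cdom (chart_at \<A> x)"
    using chart_at[OF assms(2)] openin_cdom by (metis neighbourhood_base_of)
  then show ?thesis
    using chart_at[OF assms(2)] closedin_compact_space[OF assms(1)] by blast
qed

text \<open>Ensures that the \<open>SOME\<close> in \<open>form_integral\<close> really selects a
  partition.\<close>

lemma chart_partition_exists:
  assumes "compact_space M"
  shows "\<exists>P. chart_partition M \<A> P"
proof -
  let ?\<Sigma> = "sigma_sets (topspace M) {U. openin M U}"
  interpret \<Sigma>: sigma_algebra "topspace M" ?\<Sigma>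
    by (rule sigma_algebra_sigma_sets) (auto dest: openin_subset)
  obtain C V K where CVK: "\<And>x. x \<in> topspace M \<Longrightarrow> C x \<in> \<A> \<and> openin M (V x) \<and> compactin M (K x) \<and>
      x \<in> V x \<and> V x \<subseteq> K x \<and> K x \<subseteq> cdom (C x)"
    using compact_chart_neighbourhood[OF assms] by metis
  have "\<forall>U\<in>V ` topspace M. openin M U" "topspace M \<subseteq> \<Union>(V ` topspace M)"
    using CVK by auto
  then obtain \<F> where "finite \<F>" "\<F> \<subseteq> V ` topspace M" "topspace M \<subseteq> \<Union>\<F>"
    using assms[unfolded compact_space_alt, rule_format, of "V ` topspace M"] by auto
  then obtain X where X: "finite X" "X \<subseteq> topspace M" "\<F> = V ` X"
    by (meson finite_subset_image)
  obtain e :: "nat \<Rightarrow> 'm" and n where e: "X = e ` {..<n}"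
    using finite_imp_nat_seg_image_inj_on[OF X(1)] by (metis lessThan_def)
  \<comment> \<open>The finite subcover is made disjoint: a point goes to the first neighbourhood
    that contains it.\<close>
  define W where "W i = V (e i) - (\<Union>j<i. V (e j))" for i
  have eX: "e i \<in> topspace M" if "i < n" for i using that e X by auto
  note CVKe = CVK[OF eX]
  have W\<Sigma>: "W i \<in> ?\<Sigma>" if "i < n" for i
  proof -
    have V\<Sigma>: "V (e j) \<in> ?\<Sigma>" if "j < n" for j using CVKe[OF that] by blast
    have "(\<Union>j<i. V (e j)) \<in> ?\<Sigma>"
      using V\<Sigma> that by (intro \<Sigma>.finite_UN) auto
    then show ?thesis
      unfolding W_def using V\<Sigma>[OF that] \<Sigma>.Diff by blast
  qed
  have Wdisj: "W i \<inter> W j = {}" if "i \<noteq> j" for i j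
    using that by (cases i j rule: linorder_cases) (auto simp: W_def)
  have WV: "W i \<subseteq> V (e i)" for i by (auto simp: W_def)
  have WU: "(\<Union>i<n. W i) = topspace M"
  proof
    show "(\<Union>i<n. W i) \<subseteq> topspace M"
      using CVKe WV openin_subset by blast
    show "topspace M \<subseteq> (\<Union>i<n. W i)"
    proof
      fix x assume "x \<in> topspace M"
      then have ex: "\<exists>i. i < n \<and> x \<in> V (e i)" using \<open>topspace M \<subseteq> \<Union>\<F>\<close> X e by auto
      define i where "i = (LEAST i. i < n \<and> x \<in> V (e i))"
      have i: "i < n" "x \<in> V (e i)" using LeastI_ex[OF ex] by (auto simp: i_def)
      moreover have "x \<notin> V (e j)" if "j < i" for j
        using not_less_Least[of j "\<lambda>i. i < n \<and> x \<in> V (e i)"] that i by (auto simp: i_def)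
      ultimately show "x \<in> (\<Union>i<n. W i)" by (auto simp: W_def)
    qed
  qed
  \<comment> \<open>Several points of the subcover may have been given the same chart, but a
    partition has one piece per chart; such pieces are merged.\<close>
  define P where "P c = (\<Union>i\<in>{i. i < n \<and> C (e i) = c}. W i)" for c
  have "chart_partition M \<A> P"
    unfolding chart_partition_def
  proof (intro conjI ballI)
    have "{c \<in> \<A>. P c \<noteq> {}} \<subseteq> (\<lambda>i. C (e i)) ` {..<n}" unfolding P_def by blast
    then show "finite {c \<in> \<A>. P c \<noteq> {}}" by (rule finite_subset) simp
    show "disjoint_family_on P \<A>"
      unfolding disjoint_family_on_def
    proof (intro ballI impI equals0I)
      fix c c' z assume "c \<noteq> c'" "z \<in> P c \<inter> P c'"
      then obtain i j where "z \<in> W i" "C (e i) = c" "z \<in> W j" "C (e j) = c'"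
        unfolding P_def by blast
      with Wdisj[of i j] \<open>c \<noteq> c'\<close> show False by blast
    qed
    have "C (e i) \<in> \<A>" if "i < n" for i using CVKe[OF that] by blast
    then have "(\<Union>c\<in>\<A>. P c) = (\<Union>i<n. W i)" unfolding P_def by blast
    then show "(\<Union>c\<in>\<A>. P c) = topspace M" using WU by simp
    fix c
    show "P c \<in> ?\<Sigma>"
      unfolding P_def using W\<Sigma> by (intro \<Sigma>.finite_UN) auto
    have "compactin M (\<Union>i\<in>{i. i < n \<and> C (e i) = c}. K (e i))"
      using CVKe by (intro compactin_Union) auto
    moreover have "P c \<subseteq> (\<Union>i\<in>{i. i < n \<and> C (e i) = c}. K (e i))"
      using CVKe WV unfolding P_def by blast
    moreover have "(\<Union>i\<in>{i. i < n \<and> C (e i) = c}. K (e i)) \<subseteq> cdom c"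
      using CVKe by blast
    ultimately show "\<exists>K. compactin M K \<and> P c \<subseteq> K \<and> K \<subseteq> cdom c" by blast
  qed
  then show ?thesis by blast
qed

end

section \<open>The first variation of the volume\<close>

lemma bounded_bilinear_lorentz: "bounded_bilinear lorentz"
proof
  show "lorentz (a + a') b = lorentz a b + lorentz a' b" for a a' b :: "'n::finite minkowski"
    by (simp add: lorentz_def algebra_simps)
  show "lorentz a (b + b') = lorentz a b + lorentz a b'" for a b b' :: "'n::finite minkowski"
    by (simp add: lorentz_def algebra_simps)
  show "lorentz (r *\<^sub>R a) b = r *\<^sub>R lorentz a b" for r and a b :: "'n::finite minkowski"
    by (simp add: lorentz_def algebra_simps)
  show "lorentz a (r *\<^sub>R b) = r *\<^sub>R lorentz a b" for r and a b :: "'n::finite minkowski"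
    by (simp add: lorentz_def algebra_simps)
  show "\<exists>K. \<forall>a b :: 'n::finite minkowski. norm (lorentz a b) \<le> norm a * norm b * K"
  proof (intro exI allI)
    fix a b :: "'n::finite minkowski"
    have "\<bar>fst a * fst b\<bar> \<le> norm a * norm b"
      using norm_fst_le[of "fst a" "snd a"] norm_fst_le[of "fst b" "snd b"]
      by (auto simp: abs_mult intro!: mult_mono)
    moreover have "\<bar>snd a \<bullet> snd b\<bar> \<le> norm a * norm b"
      using norm_snd_le[of "snd a" "fst a"] norm_snd_le[of "snd b" "fst b"]
      by (auto intro!: order_trans[OF Cauchy_Schwarz_ineq2] mult_mono)
    \<comment> \<open>One unit each for the time product and the spatial inner product.\<close>
    ultimately show "norm (lorentz a b) \<le> norm a * norm b * 2"
      by (simp add: lorentz_def)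
  qed
qed

interpretation lorentz: bounded_bilinear lorentz
  by (rule bounded_bilinear_lorentz)

lemma lorentz_commute: "lorentz a b = lorentz b a"
  by (simp add: lorentz_def inner_commute mult.commute)

text \<open>The Lorentz form is indefinite, but positive on the range of \<open>D\<close>.
  \<open>L u\<close> represents the functional pairing \<open>u\<close> with that range; positivity
  makes \<open>u \<mapsto> L (D u)\<close> injective, hence surjective by dimension, so some
  \<open>D u\<close> has the same pairings as \<open>a\<close>.\<close>

lemma spacelike_orthogonal_decomposition:
  fixes D :: "real ^ 'n::finite \<Rightarrow> 'n minkowski"
  assumes D: "linear D" and pos: "\<And>u. u \<noteq> 0 \<Longrightarrow> 0 < lorentz (D u) (D u)"
  obtains u where "\<And>w. lorentz (a - D u) (D w) = 0"
proof -
  define L where "L u = (\<chi> j. lorentz u (D (axis j 1)))" for u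
  have L: "w \<bullet> L u = lorentz u (D w)" for u w
  proof -
    have "D w = D (\<Sum>j\<in>UNIV. w $ j *\<^sub>R axis j 1)"
      by (metis basis_expansion scalar_mult_eq_scaleR)
    also have "\<dots> = (\<Sum>j\<in>UNIV. w $ j *\<^sub>R D (axis j 1))"
      by (simp add: linear_sum[OF D] linear_scale[OF D])
    finally show ?thesis
      by (simp add: lorentz.sum_right lorentz.scaleR_right L_def inner_vec_def)
  qed
  have lin: "linear (\<lambda>u. L (D u))"
    by (rule linearI) (simp_all add: L_def vec_eq_iff linear_add[OF D] linear_scale[OF D]
        lorentz.add_left lorentz.scaleR_left)
  have "u = 0" if "L (D u) = 0" for u
    using pos[of u] L[of u "D u"] that by auto
  then have "inj (\<lambda>u. L (D u))"
    using linear_injective_0[OF lin] by blast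
  then have "surj (\<lambda>u. L (D u))" by (rule linear_inj_imp_surj[OF lin])
  then obtain u where "L a = L (D u)" by (metis surjD)
  then have "lorentz (a - D u) (D w) = 0" for w
    using L[of w a] L[of w "D u"] by (simp add: lorentz.diff_left)
  then show ?thesis by (rule that)
qed

context smooth_manifold
begin

text \<open>Replaces the projection in the second fundamental form: passing to the normal part
  subtracts a tangent vector, which pairs to zero with a normal \<open>b\<close>.\<close>

lemma lorentz_normal_part:
  assumes c: "c \<in> \<A>" "x \<in> cdom c"
    and D: "linear D" "\<And>u. differential \<A> p x (coord_vector \<A> c x u) = D u"
    and pos: "\<And>u. u \<noteq> 0 \<Longrightarrow> 0 < lorentz (D u) (D u)"
    and b: "\<And>u. lorentz (D u) b = 0"
  shows "lorentz (normal_part \<A> p x a) b = lorentz a b"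
proof -
  obtain u where u: "\<And>w. lorentz (a - D u) (D w) = 0"
    using spacelike_orthogonal_decomposition[OF D(1) pos] by metis
  have tan: "v \<in> tangent_space \<A> x \<longleftrightarrow> (\<exists>w. v = coord_vector \<A> c x w)" for v
    using tangent_vector_eq[OF _ c] coord_vector_in_tangent_space[OF c] by metis
  have img: "a - \<nu> \<in> differential \<A> p x ` tangent_space \<A> x \<longleftrightarrow> (\<exists>w. a - \<nu> = D w)" for \<nu>
    using tan D(2) by (metis (no_types, lifting) image_iff)
  have orth: "(\<forall>v\<in>tangent_space \<A> x. lorentz \<nu> (differential \<A> p x v) = 0) \<longleftrightarrow> (\<forall>w. lorentz \<nu> (D w) = 0)" for \<nu>
    using tan D(2) by metis
  have "normal_part \<A> p x a = (THE \<nu>. (\<forall>w. lorentz \<nu> (D w) = 0) \<and> (\<exists>w. a - \<nu> = D w))"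
    unfolding normal_part_def orth img ..
  also have "\<dots> = a - D u"
  proof (rule the_equality)
    show "(\<forall>w. lorentz (a - D u) (D w) = 0) \<and> (\<exists>w. a - (a - D u) = D w)" using u by auto
    fix \<nu> assume \<nu>: "(\<forall>w. lorentz \<nu> (D w) = 0) \<and> (\<exists>w. a - \<nu> = D w)"
    then obtain w where w: "a - \<nu> = D w" by auto
    have 1: "D (u - w) = \<nu> - (a - D u)"
      using w by (simp add: linear_diff[OF D(1)] algebra_simps)
    \<comment> \<open>The difference of two candidates for \<open>THE\<close> is both tangent and
      orthogonal to all tangent vectors, so positivity forces it to vanish.\<close>
    have "lorentz (\<nu> - (a - D u)) (D (u - w)) = 0"
      using \<nu> u by (simp add: lorentz.diff_left)
    then have "lorentz (D (u - w)) (D (u - w)) = 0" by (simp only: 1)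
    then have "u - w = 0" using pos[of "u - w"] by fastforce
    then have "D (u - w) = 0" using linear_0[OF D(1)] by simp
    then show "\<nu> = a - D u" using 1 by simp
  qed
  finally show ?thesis by (simp add: lorentz.diff_left b)
qed

end

locale admissible_variation = smooth_manifold M \<A>
  for M :: "'m topology" and \<A> :: "('m, 'n::finite) chart set" +
  fixes g :: "('m, 'n) metric_field" and p q :: "'m \<Rightarrow> 'n minkowski"
    and A :: "'m \<Rightarrow> ('m, 'n) tangent \<Rightarrow> ('m, 'n) tangent"
    and \<epsilon> :: real and F :: "real \<Rightarrow> 'm \<Rightarrow> 'n minkowski"
  assumes oriented: "oriented_atlas \<A>"
    and riemannian: "riemannian_metric \<A> g"
    and isometric: "isometric_immersion_light_cone M \<A> g p"
    and dual: "dual_map M \<A> p q"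
    and shape: "shape_operator M \<A> p q A"
    and variation: "variation M \<A> p \<epsilon> F"
    and admissible: "admissible M q F"
begin

section \<open>The variation in a chart: frame, Gram matrix and velocity\<close>

abbreviation interval where "interval \<equiv> {-\<epsilon><..<\<epsilon>}"

text \<open>Time and chart point form a pair, so that \<open>smooth_on\<close> expresses joint
  smoothness in both.\<close>

definition position where
  "position c = (\<lambda>(t, y). F t (cinv c y))"

definition frame where
  "frame c v = (\<lambda>(t, y). frechet_derivative (\<lambda>y. position c (t, y)) (at y within cimg c) v)"

definition gram :: "('m, 'n) chart \<Rightarrow> real \<times> (real ^ 'n) \<Rightarrow> real ^ 'n ^ 'n" where
  "gram c z = (\<chi> i j. lorentz (frame c (axis i 1) z) (frame c (axis j 1) z))"

definition velocity where
  "velocity c y = vector_derivative (\<lambda>t. position c (t, y)) (at 0)"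

lemma zero_in_interval: "0 \<in> interval"
  using variation by (simp add: variation_def)

lemma smooth_position: "c \<in> \<A> \<Longrightarrow> smooth_on (interval \<times> cimg c) (position c)"
  using variation by (simp add: variation_def position_def)

lemma smooth_frame: "c \<in> \<A> \<Longrightarrow> smooth_on (interval \<times> cimg c) (frame c v)"
  unfolding frame_def by (rule smooth_on_space_derivative[OF openin_cimg smooth_position])

lemma smooth_det_gram: "c \<in> \<A> \<Longrightarrow> smooth_on (interval \<times> cimg c) (\<lambda>z. det (gram c z))"
  by (intro smooth_on_det) (simp add: gram_def smooth_on_bounded_bilinear[OF bounded_bilinear_lorentz] smooth_frame)

lemma smooth_velocity:
  assumes "c \<in> \<A>"
  shows "smooth_on (cimg c) (velocity c)"
  using smooth_on_slice[OF smooth_on_time_derivative[OF _ smooth_position[OF assms]] zero_in_interval]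
  by (simp add: velocity_def[abs_def])

lemma frame_has_derivative:
  assumes "c \<in> \<A>" "t \<in> interval" "y \<in> cimg c"
  shows "(F t \<circ> cinv c has_derivative (\<lambda>v. frame c v (t, y))) (at y within cimg c)"
  using smooth_on_imp_differentiable_within[OF smooth_on_slice[OF smooth_position[OF assms(1)] assms(2)] assms(3)]
  by (simp add: frame_def position_def frechet_derivative_works o_def)

lemma initial_frame_has_derivative:
  assumes c: "c \<in> \<A>" and y: "y \<in> cimg c"
  shows "(p \<circ> cinv c has_derivative (\<lambda>v. frame c v (0, y))) (at y within cimg c)"
proof -
  have "(p \<circ> cinv c) z = (F 0 \<circ> cinv c) z" if "z \<in> cimg c" for z
    using variation in_topspace[OF c cinv_in[OF that]] by (simp add: variation_def)
  then show ?thesis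
    by (rule has_derivative_transform[OF y _ frame_has_derivative[OF c zero_in_interval y]])
qed

lemma differential_coord:
  assumes "c \<in> \<A>" "x \<in> cdom c" "t \<in> interval"
  shows "differential \<A> (F t) x (coord_vector \<A> c x u) = frame c u (t, cmap c x)"
  by (rule differential_coord_vector[OF assms(1,2) frame_has_derivative[OF assms(1,3) imageI[OF assms(2)]]])

lemma initial_differential_coord:
  assumes "c \<in> \<A>" "x \<in> cdom c"
  shows "differential \<A> p x (coord_vector \<A> c x u) = frame c u (0, cmap c x)"
  by (rule differential_coord_vector[OF assms initial_frame_has_derivative[OF assms(1) imageI[OF assms(2)]]])

lemma linear_initial_frame:
  assumes "c \<in> \<A>" "y \<in> cimg c"
  shows "linear (\<lambda>u. frame c u (0, y))"
  using initial_frame_has_derivative[OF assms] by (rule has_derivative_linear)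

lemma gram_eq_metric:
  assumes "c \<in> \<A>" "x \<in> cdom c" "t \<in> interval"
  shows "gram c (t, cmap c x) = (\<chi> i j. induced_metric \<A> (F t) x
    (coord_vector \<A> c x (axis i 1)) (coord_vector \<A> c x (axis j 1)))"
  by (simp add: gram_def induced_metric_def differential_coord[OF assms])

lemma volume_density:
  assumes "c \<in> \<A>" "x \<in> cdom c" "t \<in> interval"
  shows "volume_form \<A> (induced_metric \<A> (F t)) x (\<lambda>i. coord_vector \<A> c x (axis i 1)) =
    sqrt (det (gram c (t, cmap c x)))"
  by (simp add: volume_form_coord_frame[OF oriented assms(1,2)] gram_eq_metric[OF assms])

text \<open>Every \<open>F t\<close> is spacelike, so positivity holds throughout the interval. The
  square root is therefore differentiable for all these \<open>t\<close>, as differentiation under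
  the integral requires.\<close>

lemma det_gram_pos:
  assumes "c \<in> \<A>" "t \<in> interval" "y \<in> cimg c"
  shows "0 < det (gram c (t, y))"
proof (rule det_pos_if_positive_definite)
  fix u :: "real ^ 'n" assume u: "u \<noteq> 0"
  obtain x where x: "x \<in> cdom c" "y = cmap c x" using assms(3) by auto
  have R: "riemannian_metric \<A> (induced_metric \<A> (F t))"
    using variation assms(2) by (simp add: variation_def spacelike_immersion_def)
  then have bil: "bilinear (\<lambda>u w. induced_metric \<A> (F t) x (coord_vector \<A> c x u) (coord_vector \<A> c x w))"
    using assms(1) x(1) unfolding riemannian_metric_def by blast
  show "0 < u \<bullet> (gram c (t, y) *v u)"
    unfolding x(2) gram_eq_metric[OF assms(1) x(1) assms(2)]
      gram_quadratic_form[where g="induced_metric \<A> (F t)", OF bil]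
    by (rule gram_pos[OF R assms(1) x(1) u])
qed

lemma initial_frame_spacelike:
  assumes "c \<in> \<A>" "x \<in> cdom c" "u \<noteq> 0"
  shows "0 < lorentz (frame c u (0, cmap c x)) (frame c u (0, cmap c x))"
proof -
  have "induced_metric \<A> p x (coord_vector \<A> c x u) (coord_vector \<A> c x u) =
      g x (coord_vector \<A> c x u) (coord_vector \<A> c x u)"
    using isometric coord_vector_in_tangent_space[OF assms(1,2)] in_topspace[OF assms(1,2)]
    unfolding isometric_immersion_light_cone_def by blast
  then show ?thesis
    using gram_pos[OF riemannian assms]
    by (simp add: induced_metric_def initial_differential_coord[OF assms(1,2)])
qed

lemma dual_orthogonal:
  assumes "c \<in> \<A>" "x \<in> cdom c"
  shows "lorentz (frame c u (0, cmap c x)) (q x) = 0"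
proof -
  have "lorentz (differential \<A> p x (coord_vector \<A> c x u)) (q x) = 0"
    using dual in_topspace[OF assms] coord_vector_in_tangent_space[OF assms]
    unfolding dual_map_def by blast
  then show ?thesis by (simp add: initial_differential_coord[OF assms])
qed

text \<open>Pairing with \<open>p\<close> recovers the coefficient of the variational field, because \<open>\<langle>p, q\<rangle> = 1\<close>.\<close>

lemma velocity_eq:
  assumes "c \<in> \<A>" "x \<in> cdom c"
  shows "velocity c (cmap c x) = lorentz (variational_field F x) (p x) *\<^sub>R q x"
proof -
  obtain \<phi> where \<phi>: "variational_field F x = \<phi> *\<^sub>R q x"
    using admissible in_topspace[OF assms] unfolding admissible_def by blast
  have "lorentz (p x) (q x) = 1"
    using dual in_topspace[OF assms] unfolding dual_map_def by blast
  then have "lorentz (variational_field F x) (p x) = \<phi>"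
    by (simp add: \<phi> lorentz.scaleR_left lorentz_commute[of "q x"])
  moreover have "velocity c (cmap c x) = variational_field F x"
    by (simp add: velocity_def position_def variational_field_def cinv_cmap[OF assms])
  ultimately show ?thesis by (simp add: \<phi>)
qed

text \<open>Here admissibility meets the normality of the dual map. The identity holds on the entire
  chart image and can therefore be differentiated in \<open>y\<close>.\<close>

lemma velocity_orthogonal:
  assumes "c \<in> \<A>" "y \<in> cimg c"
  shows "lorentz (velocity c y) (frame c w (0, y)) = 0"
  using assms dual_orthogonal[OF assms(1)] velocity_eq[OF assms(1)]
  by (auto simp: lorentz.scaleR_left lorentz_commute[of "q _"])

lemma smooth_initial_frame: "c \<in> \<A> \<Longrightarrow> smooth_on (cimg c) (\<lambda>y. frame c w (0, y))"
  by (rule smooth_on_slice[OF smooth_frame zero_in_interval])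

section \<open>Time derivatives at \<open>t = 0\<close>\<close>

lemma frame_time_derivative:
  assumes c: "c \<in> \<A>" and y: "y \<in> cimg c"
  shows "((\<lambda>t. frame c u (t, y)) has_vector_derivative
    frechet_derivative (velocity c) (at y within cimg c) u) (at 0)"
proof -
  have "vector_derivative (\<lambda>t. frame c u (t, y)) (at 0) = frechet_derivative (velocity c) (at y within cimg c) u"
    using time_space_derivative_commute[OF openin_cimg[OF c] _ smooth_position[OF c] zero_in_interval y, of u]
    by (simp add: frame_def velocity_def[abs_def])
  then show ?thesis
    using smooth_on_time_has_derivative[OF _ smooth_frame[OF c] zero_in_interval y, of u] by simp
qed

text \<open>Differentiating \<open>velocity_orthogonal\<close> avoids any derivative of the coefficient of \<open>q\<close>.\<close>

lemma velocity_derivative: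
  assumes c: "c \<in> \<A>" and y: "y \<in> cimg c"
  shows "lorentz (frechet_derivative (velocity c) (at y within cimg c) u) (frame c w (0, y)) =
    - lorentz (velocity c y) (frechet_derivative (\<lambda>y. frame c w (0, y)) (at y within cimg c) u)"
proof -
  let ?V = "frechet_derivative (velocity c) (at y within cimg c)"
  let ?W = "frechet_derivative (\<lambda>y. frame c w (0, y)) (at y within cimg c)"
  have "(velocity c has_derivative ?V) (at y within cimg c)"
    using smooth_on_imp_differentiable_within[OF smooth_velocity[OF c] y] by (simp only: frechet_derivative_works)
  moreover have "((\<lambda>y. frame c w (0, y)) has_derivative ?W) (at y within cimg c)"
    using smooth_on_imp_differentiable_within[OF smooth_initial_frame[OF c] y] by (simp only: frechet_derivative_works)
  ultimately have "((\<lambda>y. lorentz (velocity c y) (frame c w (0, y))) has_derivative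
      (\<lambda>h. lorentz (velocity c y) (?W h) + lorentz (?V h) (frame c w (0, y)))) (at y within cimg c)"
    by (rule lorentz.FDERIV)
  moreover have "((\<lambda>y. lorentz (velocity c y) (frame c w (0, y))) has_derivative (\<lambda>h. 0)) (at y within cimg c)"
    by (rule has_derivative_transform[OF y _ has_derivative_const]) (rule velocity_orthogonal[OF c])
  ultimately have "(\<lambda>h. lorentz (velocity c y) (?W h) + lorentz (?V h) (frame c w (0, y))) = (\<lambda>h. 0)"
    by (rule rel_open_half_space_derivative_unique[OF openin_cimg[OF c] y])
  from fun_cong[OF this, of u] show ?thesis by simp
qed

text \<open>For coordinate fields the flat derivative of \<open>dp(Z)\<close> along \<open>Y\<close>
  is a second coordinate derivative of \<open>p\<close>; as \<open>q\<close> is normal, the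
  projection in the second fundamental form does not affect the pairing.\<close>

lemma shape_operator_coord:
  assumes c: "c \<in> \<A>" and x: "x \<in> cdom c"
  shows "lorentz (differential \<A> p x (A x (coord_vector \<A> c x u))) (frame c w (0, cmap c x)) =
    lorentz (frechet_derivative (\<lambda>y. frame c w (0, y)) (at (cmap c x) within cimg c) u) (q x)"
proof -
  let ?Y = "\<lambda>x. coord_vector \<A> c x u" and ?Z = "\<lambda>x. coord_vector \<A> c x w"
  note y = imageI[OF x, of "cmap c"]
  have "lorentz (differential \<A> p x (A x (?Y x))) (differential \<A> p x (?Z x)) =
      lorentz (second_fundamental_form \<A> p ?Y ?Z x) (q x)"
    using shape openin_cdom[OF c] coord_vector_field[OF c] x unfolding shape_operator_def by blast
  also have "\<dots> = lorentz (differential \<A> (\<lambda>y. differential \<A> p y (?Z y)) x (?Y x)) (q x)"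
    unfolding second_fundamental_form_def
    by (rule lorentz_normal_part[OF c x linear_initial_frame[OF c y] initial_differential_coord[OF c x]
        initial_frame_spacelike[OF c x] dual_orthogonal[OF c x]])
  also have "differential \<A> (\<lambda>y. differential \<A> p y (?Z y)) x (?Y x) =
      frechet_derivative (\<lambda>y. frame c w (0, y)) (at (cmap c x) within cimg c) u"
  proof (rule differential_coord_vector[OF c x])
    have "((\<lambda>y. frame c w (0, y)) has_derivative
        frechet_derivative (\<lambda>y. frame c w (0, y)) (at (cmap c x) within cimg c)) (at (cmap c x) within cimg c)"
      using smooth_on_imp_differentiable_within[OF smooth_initial_frame[OF c] y] by (simp only: frechet_derivative_works)
    then show "((\<lambda>y. differential \<A> p y (?Z y)) \<circ> cinv c has_derivative
        frechet_derivative (\<lambda>y. frame c w (0, y)) (at (cmap c x) within cimg c)) (at (cmap c x) within cimg c)"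
      by (rule has_derivative_transform[OF y, rotated])
        (simp add: initial_differential_coord[OF c cinv_in] cmap_cinv)
  qed
  finally show ?thesis by (simp add: initial_differential_coord[OF c x])
qed

text \<open>The derivative is put in the form of a matrix times the Gram matrix, ready for
  \<open>det_has_real_derivative\<close>.\<close>

lemma gram_time_derivative:
  fixes i j :: 'n
  assumes c: "c \<in> \<A>" and x: "x \<in> cdom c"
  defines "\<phi> \<equiv> lorentz (variational_field F x) (p x)"
    and "a \<equiv> matrix (\<lambda>u. A x (coord_vector \<A> c x u) c)"
  shows "((\<lambda>t. gram c (t, cmap c x) $ i $ j) has_real_derivative
    (((- 2 * \<phi>) *\<^sub>R transpose a) ** gram c (0, cmap c x)) $ i $ j) (at 0)"
proof -
  note y = imageI[OF x, of "cmap c"]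
  let ?e = "\<lambda>i. axis i 1 :: real ^ 'n"
  let ?V = "\<lambda>u. frechet_derivative (velocity c) (at (cmap c x) within cimg c) u"
  let ?W = "\<lambda>w u. frechet_derivative (\<lambda>y. frame c w (0, y)) (at (cmap c x) within cimg c) u"
  let ?f = "\<lambda>u. frame c u (0, cmap c x)"
  have end_A: "tangent_endomorphism \<A> x (A x)"
    using shape in_topspace[OF c x] by (simp add: shape_operator_def)
  have 1: "((\<lambda>t. gram c (t, cmap c x) $ i $ j) has_vector_derivative
      lorentz (?f (?e i)) (?V (?e j)) + lorentz (?V (?e i)) (?f (?e j))) (at 0)"
    unfolding gram_def by (simp only: vec_lambda_beta) (rule lorentz.has_vector_derivative[OF frame_time_derivative[OF c y] frame_time_derivative[OF c y]])
  \<comment> \<open>The derivative is shifted from the velocity to the frame; the velocity that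
    remains is \<open>\<phi>\<close> times \<open>q\<close>, whose pairing with a second derivative
    of \<open>p\<close> is the shape operator.\<close>
  have 2: "lorentz (?V u) (?f w) = - \<phi> * lorentz (differential \<A> p x (A x (coord_vector \<A> c x u))) (?f w)" for u w
    by (simp add: velocity_derivative[OF c y] velocity_eq[OF c x] shape_operator_coord[OF c x] \<phi>_def
        lorentz.scaleR_left lorentz_commute[of "q x"])
  \<comment> \<open>Self-adjointness of \<open>A\<close>, inherited from the symmetry of second
    derivatives. It makes the two summands of \<open>1\<close> equal.\<close>
  have 3: "lorentz (differential \<A> p x (A x (coord_vector \<A> c x u))) (?f w) =
      lorentz (differential \<A> p x (A x (coord_vector \<A> c x w))) (?f u)" for u w
  proof -
    have "?W w u = ?W u w"
      using rel_open_second_derivative_symmetric[OF openin_cimg[OF c]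
          smooth_on_slice[OF smooth_position[OF c] zero_in_interval] y, of w u]
      by (simp add: frame_def)
    then show ?thesis by (simp add: shape_operator_coord[OF c x])
  qed
  \<comment> \<open>The components of \<open>A\<close> on the \<open>i\<close>-th coordinate vector
    form column \<open>i\<close> of \<open>a\<close>, whereas the product with the Gram matrix uses
    row \<open>i\<close>; hence the transpose.\<close>
  have 4: "lorentz (differential \<A> p x (A x (coord_vector \<A> c x (?e i)))) (?f (?e j)) =
      (transpose a ** gram c (0, cmap c x)) $ i $ j"
  proof -
    have "A x (coord_vector \<A> c x (?e i)) \<in> tangent_space \<A> x"
      using end_A coord_vector_in_tangent_space[OF c x] unfolding tangent_endomorphism_def by blast
    then have "A x (coord_vector \<A> c x (?e i)) = coord_vector \<A> c x (A x (coord_vector \<A> c x (?e i)) c)"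
      using tangent_vector_eq[OF _ c x] by metis
    then have "differential \<A> p x (A x (coord_vector \<A> c x (?e i))) = ?f (A x (coord_vector \<A> c x (?e i)) c)"
      using initial_differential_coord[OF c x] by metis
    also have "A x (coord_vector \<A> c x (?e i)) c = (\<Sum>k\<in>UNIV. a $ k $ i *\<^sub>R ?e k)"
      using basis_expansion[of "A x (coord_vector \<A> c x (?e i)) c"]
      by (simp add: a_def matrix_def scalar_mult_eq_scaleR)
    also have "?f (\<Sum>k\<in>UNIV. a $ k $ i *\<^sub>R ?e k) = (\<Sum>k\<in>UNIV. a $ k $ i *\<^sub>R ?f (?e k))"
      by (simp add: linear_sum[OF linear_initial_frame[OF c y]] linear_scale[OF linear_initial_frame[OF c y]])
    finally show ?thesis
      by (simp add: lorentz.sum_left lorentz.scaleR_left matrix_matrix_mult_def transpose_def gram_def)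
  qed
  have "lorentz (?f (?e i)) (?V (?e j)) + lorentz (?V (?e i)) (?f (?e j)) =
      - 2 * \<phi> * (transpose a ** gram c (0, cmap c x)) $ i $ j"
    using 2[of "?e i" "?e j"] 2[of "?e j" "?e i"] 3[of "?e i" "?e j"] 4
    by (simp add: lorentz_commute[of "?f (?e i)"])
  moreover have "(((- 2 * \<phi>) *\<^sub>R transpose a) ** gram c (0, cmap c x)) $ i $ j =
      - 2 * \<phi> * (transpose a ** gram c (0, cmap c x)) $ i $ j"
    by (simp add: matrix_matrix_mult_def sum_distrib_left mult.assoc sum_negf)
  ultimately show ?thesis
    using 1 by (simp only: has_real_derivative_iff_has_vector_derivative)
qed

lemma density_time_derivative:
  assumes c: "c \<in> \<A>" and x: "x \<in> cdom c"
  shows "((\<lambda>t. sqrt (det (gram c (t, cmap c x)))) has_real_derivative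
    - (tangent_trace \<A> x (A x) * lorentz (variational_field F x) (p x) * sqrt (det (gram c (0, cmap c x))))) (at 0)"
proof -
  define a where "a = matrix (\<lambda>u. A x (coord_vector \<A> c x u) c)"
  define \<phi> where "\<phi> = lorentz (variational_field F x) (p x)"
  have pos: "0 < det (gram c (0, cmap c x))"
    using det_gram_pos[OF c zero_in_interval] x by simp
  have "tangent_endomorphism \<A> x (A x)"
    using shape in_topspace[OF c x] by (simp add: shape_operator_def)
  then have tr: "trace a = tangent_trace \<A> x (A x)"
    unfolding a_def by (rule tangent_trace_eq[OF _ c x, symmetric])
  have "trace ((- 2 * \<phi>) *\<^sub>R transpose a) = - 2 * \<phi> * trace a"
    by (simp add: trace_def transpose_def sum_distrib_left sum_negf)
  with det_has_real_derivative[of "\<lambda>t. gram c (t, cmap c x)" "(- 2 * \<phi>) *\<^sub>R transpose a" 0,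
      OF gram_time_derivative[OF c x, folded \<phi>_def a_def]]
  have "((\<lambda>t. det (gram c (t, cmap c x))) has_real_derivative
      (- 2 * \<phi> * trace a) * det (gram c (0, cmap c x))) (at 0)" by simp
  note DERIV_chain2[OF DERIV_real_sqrt[OF pos] this]
  moreover have "inverse (sqrt d) / 2 * (- 2 * \<phi> * trace a * d) = - (trace a * \<phi> * sqrt d)" if "0 < d" for d
  proof -
    have "inverse (sqrt d) * d = sqrt d"
      using that real_div_sqrt[of d] by (simp add: field_simps)
    then show ?thesis by (simp add: algebra_simps)
  qed
  ultimately show ?thesis by (simp only: pos tr \<phi>_def[symmetric])
qed

text \<open>The integrand needs a jointly continuous derivative for all \<open>t\<close> of the
  interval, but the geometric formula is available only at \<open>0\<close>. So
  \<open>\<rho>'\<close> is defined through the derivative of the Gram determinant and identified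
  with that formula at \<open>t = 0\<close>.\<close>

lemma chart_volume_derivative:
  assumes c: "c \<in> \<A>" and P: "P \<in> sigma_sets (topspace M) {U. openin M U}"
    and K: "compactin M K" "P \<subseteq> K" "K \<subseteq> cdom c"
  shows "((\<lambda>t. LINT y : cmap c ` P | lborel.
      volume_form \<A> (induced_metric \<A> (F t)) (cinv c y) (\<lambda>i. coord_vector \<A> c (cinv c y) (axis i 1)))
    has_real_derivative
      - (LINT y : cmap c ` P | lborel.
        tangent_trace \<A> (cinv c y) (A (cinv c y)) * lorentz (variational_field F (cinv c y)) (p (cinv c y)) *
        volume_form \<A> (induced_metric \<A> (F 0)) (cinv c y) (\<lambda>i. coord_vector \<A> c (cinv c y) (axis i 1)))) (at 0)"
proof -
  let ?B = "cmap c ` P"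
  define G where "G z = det (gram c z)" for z
  define G' where "G' t y = vector_derivative (\<lambda>t. G (t, y)) (at t)" for t y
  define \<rho> where "\<rho> t y = sqrt (G (t, y))" for t y
  define \<rho>' where "\<rho>' t y = inverse (sqrt (G (t, y))) / 2 * G' t y" for t y
  have smooth_G: "smooth_on (interval \<times> cimg c) G"
    using smooth_det_gram[OF c] by (simp add: G_def[abs_def])
  then have cont_G: "continuous_on (interval \<times> cimg c) G"
    by (rule smooth_on_imp_continuous_on)
  have cont_G': "continuous_on (interval \<times> cimg c) (\<lambda>(t, y). G' t y)"
    using smooth_on_imp_continuous_on[OF smooth_on_time_derivative[OF _ smooth_G]] by (simp add: G'_def)
  have pos: "0 < G (t, y)" if "t \<in> interval" "y \<in> cimg c" for t y
    using det_gram_pos[OF c that] by (simp add: G_def)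
  have deriv: "((\<lambda>t. \<rho> t y) has_real_derivative \<rho>' t y) (at t)" if "t \<in> interval" "y \<in> cimg c" for t y
  proof -
    have "((\<lambda>t. G (t, y)) has_real_derivative G' t y) (at t)"
      using smooth_on_time_has_derivative[OF _ smooth_G that]
      by (simp add: G'_def has_real_derivative_iff_has_vector_derivative)
    from DERIV_chain2[OF DERIV_real_sqrt[OF pos[OF that]] this] show ?thesis
      by (simp add: \<rho>_def \<rho>'_def)
  qed
  have B: "?B \<in> sets borel" "?B \<subseteq> cmap c ` K" "cmap c ` K \<subseteq> cimg c"
    using cmap_image_borel[OF c P] K by auto
  have int: "((\<lambda>t. LINT y : ?B | lborel. \<rho> t y) has_real_derivative (LINT y : ?B | lborel. \<rho>' 0 y)) (at 0)"
  proof (rule has_derivative_integral_compact[where \<epsilon>=\<epsilon> and S="cimg c", OF _ _ _ deriv compact_cmap_image[OF c K(1,3)] B(3,1,2)])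
    show "0 < \<epsilon>" using variation by (simp add: variation_def)
    show "continuous_on (cimg c) (\<rho> t)" if "t \<in> interval" for t
      unfolding \<rho>_def[abs_def]
      by (intro continuous_on_real_sqrt smooth_on_imp_continuous_on smooth_on_slice[OF smooth_G that])
    have "continuous_on (interval \<times> cimg c) (\<lambda>z. inverse (sqrt (G z)) / 2 * (case z of (t, y) \<Rightarrow> G' t y))"
      using pos by (intro continuous_intros cont_G cont_G') fastforce+
    then show "continuous_on (interval \<times> cimg c) (\<lambda>(t, y). \<rho>' t y)"
      by (rule continuous_on_eq) (auto simp: \<rho>'_def)
  qed
  have vol: "(LINT y : ?B | lborel. \<rho> t y) = (LINT y : ?B | lborel.
      volume_form \<A> (induced_metric \<A> (F t)) (cinv c y) (\<lambda>i. coord_vector \<A> c (cinv c y) (axis i 1)))"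
    if "t \<in> interval" for t
  proof (rule set_lebesgue_integral_cong)
    show "\<forall>y. y \<in> ?B \<longrightarrow> \<rho> t y =
      volume_form \<A> (induced_metric \<A> (F t)) (cinv c y) (\<lambda>i. coord_vector \<A> c (cinv c y) (axis i 1))"
      using K by (auto simp: \<rho>_def G_def cinv_cmap[OF c] volume_density[OF c _ that] subset_iff)
  qed (use B in simp)
  have "((\<lambda>t. LINT y : ?B | lborel.
      volume_form \<A> (induced_metric \<A> (F t)) (cinv c y) (\<lambda>i. coord_vector \<A> c (cinv c y) (axis i 1)))
    has_real_derivative (LINT y : ?B | lborel. \<rho>' 0 y)) (at 0)"
    \<comment> \<open>The density equals the volume form only for \<open>t\<close> in the interval,
      which suffices for the derivative at \<open>0\<close>.\<close>
    by (rule has_field_derivative_transform_within_open[OF int _ zero_in_interval vol]) simp_all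
  moreover have "(LINT y : ?B | lborel. \<rho>' 0 y) = (LINT y : ?B | lborel.
      - (tangent_trace \<A> (cinv c y) (A (cinv c y)) * lorentz (variational_field F (cinv c y)) (p (cinv c y)) *
        volume_form \<A> (induced_metric \<A> (F 0)) (cinv c y) (\<lambda>i. coord_vector \<A> c (cinv c y) (axis i 1))))"
  proof (rule set_lebesgue_integral_cong)
    have "\<rho>' 0 (cmap c x) = - (tangent_trace \<A> x (A x) * lorentz (variational_field F x) (p x) *
        volume_form \<A> (induced_metric \<A> (F 0)) x (\<lambda>i. coord_vector \<A> c x (axis i 1)))"
      if x: "x \<in> cdom c" for x
      \<comment> \<open>Both are derivatives at \<open>0\<close> of the same density.\<close>
      using DERIV_unique[OF deriv[OF zero_in_interval imageI[OF x], unfolded \<rho>_def G_def] density_time_derivative[OF c x]]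
      by (simp add: volume_density[OF c x zero_in_interval])
    then show "\<forall>y. y \<in> ?B \<longrightarrow> \<rho>' 0 y =
      - (tangent_trace \<A> (cinv c y) (A (cinv c y)) * lorentz (variational_field F (cinv c y)) (p (cinv c y)) *
        volume_form \<A> (induced_metric \<A> (F 0)) (cinv c y) (\<lambda>i. coord_vector \<A> c (cinv c y) (axis i 1)))"
      using K by (auto simp: cinv_cmap[OF c] subset_iff)
  qed (use B in simp)
  ultimately show ?thesis
    by (simp add: set_lebesgue_integral_def)
qed

text \<open>The partition chosen in \<open>form_integral\<close> depends on \<open>M\<close> and
  \<open>\<A>\<close> alone, so all \<open>t\<close> and the right-hand side share it, and the
  finite sum is differentiated chart by chart.\<close>

lemma total_volume_derivative:
  assumes "compact_space M"
  shows "((\<lambda>t. total_volume M \<A> (induced_metric \<A> (F t))) has_real_derivative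
    - form_integral M \<A> (\<lambda>x v. tangent_trace \<A> x (A x) * lorentz (variational_field F x) (p x) *
        volume_form \<A> (induced_metric \<A> (F 0)) x v)) (at 0)"
proof -
  define P where "P = (SOME P. chart_partition M \<A> P)"
  have P: "chart_partition M \<A> P"
    unfolding P_def by (rule someI_ex[OF chart_partition_exists[OF assms]])
  show ?thesis
    unfolding total_volume_def form_integral_def P_def[symmetric] Let_def sum_negf[symmetric]
  proof (rule DERIV_sum)
    fix c assume "c \<in> {c \<in> \<A>. P c \<noteq> {}}"
    then have c: "c \<in> \<A>" by simp
    with P obtain K where "P c \<in> sigma_sets (topspace M) {U. openin M U}"
      "compactin M K" "P c \<subseteq> K" "K \<subseteq> cdom c"
      unfolding chart_partition_def by blast
    then show "((\<lambda>t. LINT y : cmap c ` P c | lborel.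
        volume_form \<A> (induced_metric \<A> (F t)) (cinv c y) (\<lambda>i. coord_vector \<A> c (cinv c y) (axis i 1)))
      has_real_derivative
        - (LINT y : cmap c ` P c | lborel.
          tangent_trace \<A> (cinv c y) (A (cinv c y)) * lorentz (variational_field F (cinv c y)) (p (cinv c y)) *
          volume_form \<A> (induced_metric \<A> (F 0)) (cinv c y) (\<lambda>i. coord_vector \<A> c (cinv c y) (axis i 1)))) (at 0)"
      by (rule chart_volume_derivative[OF c])
  qed
qed

end

theorem proposition2p2:
  fixes M :: "'m topology"
    and \<A> :: "('m, 'n::finite) chart set"
    and g :: "('m, 'n) metric_field"
    and p q :: "'m \<Rightarrow> 'n minkowski"
    and A :: "'m \<Rightarrow> ('m, 'n) tangent \<Rightarrow> ('m, 'n) tangent"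
    and \<epsilon> :: real
    and F :: "real \<Rightarrow> 'm \<Rightarrow> 'n minkowski"
  assumes "2 \<le> CARD('n)"
    and "smooth_manifold_with_boundary M \<A>"
    and "compact_space M"
    and "oriented_atlas \<A>"
    and "riemannian_metric \<A> g"
    and "conformally_flat M \<A> g"
    and "isometric_immersion_light_cone M \<A> g p"
    and "dual_map M \<A> p q"
    and "shape_operator M \<A> p q A"
    and "variation M \<A> p \<epsilon> F"
    and "fixed_boundary \<A> p \<epsilon> F"
    and "admissible M q F"
  shows "((\<lambda>t. total_volume M \<A> (induced_metric \<A> (F t))) has_real_derivative
          - form_integral M \<A> (\<lambda>x v.
              tangent_trace \<A> x (A x) * lorentz (variational_field F x) (p x) *
              volume_form \<A> (induced_metric \<A> (F 0)) x v)) (at 0)"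
proof -
  interpret admissible_variation M \<A> g p q A \<epsilon> F
    by unfold_locales (fact assms)+
  show ?thesis by (rule total_volume_derivative[OF assms(3)])
qed

end
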